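(* Let $M$ be a von Neumann algebra with a faithful normal finite trace $\tau$, and let $T:L^1(M,\tau)\to L^1(M,\tau)$ be a positive contraction. Assume that there is a positive element $y\in L^1(M,\tau)$ such that $T$ is smoothing with respect to $y$. Then $\lim_{n\to\infty}\|T^n y\|_1=0$ or there is a nonzero positive $z\in L^1(M,\tau)$ such that $Tz=z$.
   Context: $M$ is a von Neumann algebra with unit and $\tau$ is a faithful normal finite trace on $M$. $M_{sa}$ is the set of self-adjoint elements of $M$ and $\nabla$ is the set of (self-adjoint) projections of $M$. $L^1(M,\tau)$ is the completion of $M$ in the norm $\|x\|_1=\tau(|x|)$; it is isometrically identified with the predual $M_*$ via $x\mapsto \tau(x\,\cdot)$. $L^1(M_{sa},\tau)$ denotes its self-adjoint part, so that $L^1(M,\tau)=L^1(M_{sa},\tau)+iL^1(M_{sa},\tau)$. A bounded linear operator $T:L^1(M,\tau)\to L^1(M,\tau)$ is positive if $Tx\ge 0$ whenever $x\ge 0$, and is a contraction if $\|Tx\|_1\le\|x\|_1$ for all $x\in L^1(M_{sa},\tau)$. Let $T$ be a positive contraction of $L^1(M,\tau)$ and let $x\in L^1(M,\tau)$ satisfy $x\ge 0$, $x\ne 0$. $T$ is called smoothing with respect to $x$ if for every $\varepsilon>0$ there exist $\delta>0$ and $n_0\in\mathbb{N}$ such that $\tau(p\,T^n x)<\varepsilon$ for every $p\in\nabla$ with $\tau(p)<\delta$ and every $n\ge n_0$. *)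

theory Defs
  imports "HOL-Analysis.Analysis" "HOL-Library.Nonpos_Ints"
begin

section \<open>Complex normed spaces and complex Hilbert spaces\<close>

class scaleC =
  fixes scaleC :: "complex \<Rightarrow> 'a \<Rightarrow> 'a"  (infixr "*\<^sub>C" 75)

class complex_normed_vector = real_normed_vector + scaleC +
  assumes scaleC_add_right: "c *\<^sub>C (x + y) = c *\<^sub>C x + c *\<^sub>C y"
    and scaleC_add_left: "(c + d) *\<^sub>C x = c *\<^sub>C x + d *\<^sub>C x"
    and scaleC_scaleC: "c *\<^sub>C (d *\<^sub>C x) = (c * d) *\<^sub>C x"
    and scaleC_of_real: "complex_of_real r *\<^sub>C x = r *\<^sub>R x"
    and norm_scaleC: "norm (c *\<^sub>C x) = cmod c * norm x"

class complex_banach = complex_normed_vector + banach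

class complex_hilbert_space = complex_banach +
  fixes cinner :: "'a \<Rightarrow> 'a \<Rightarrow> complex"
  assumes cinner_commute: "cinner x y = cnj (cinner y x)"
    and cinner_add_right: "cinner x (y + z) = cinner x y + cinner x z"
    and cinner_scaleC_right: "cinner x (c *\<^sub>C y) = c * cinner x y"
    and cinner_ge_zero: "cinner x x \<in> \<real>\<^sub>\<ge>\<^sub>0"
    and cinner_eq_zero_iff: "cinner x x = 0 \<longleftrightarrow> x = 0"
    and norm_eq_sqrt_cinner: "norm x = sqrt (Re (cinner x x))"

definition bounded_clinear :: "('a::complex_normed_vector \<Rightarrow> 'b::complex_normed_vector) \<Rightarrow> bool"
  where "bounded_clinear f \<longleftrightarrow> bounded_linear f \<and> (\<forall>c x. f (c *\<^sub>C x) = c *\<^sub>C f x)"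

lemma bounded_linear_scaleC_right:
  "bounded_linear (\<lambda>x::'a::complex_normed_vector. c *\<^sub>C x)"
proof (rule bounded_linear_intro[where K = "cmod c"])
  fix r :: real and x :: 'a
  show "c *\<^sub>C (r *\<^sub>R x) = r *\<^sub>R (c *\<^sub>C x)"
    by (simp add: scaleC_of_real[symmetric] scaleC_scaleC mult.commute)
qed (simp_all add: scaleC_add_right norm_scaleC mult.commute)

instantiation blinfun :: (real_normed_vector, complex_normed_vector) complex_normed_vector
begin

lift_definition scaleC_blinfun :: "complex \<Rightarrow> 'a \<Rightarrow>\<^sub>L 'b \<Rightarrow> 'a \<Rightarrow>\<^sub>L 'b"
  is "\<lambda>c f x. c *\<^sub>C f x"
  by (rule bounded_linear_compose[OF bounded_linear_scaleC_right])

instance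
proof
  fix c d :: complex and r :: real and f g :: "'a \<Rightarrow>\<^sub>L 'b"
  show "c *\<^sub>C (f + g) = c *\<^sub>C f + c *\<^sub>C g"
    by transfer (simp add: scaleC_add_right)
  show "(c + d) *\<^sub>C f = c *\<^sub>C f + d *\<^sub>C f"
    by transfer (simp add: scaleC_add_left)
  show scale2: "c *\<^sub>C (d *\<^sub>C f) = (c * d) *\<^sub>C f" for c d and f :: "'a \<Rightarrow>\<^sub>L 'b"
    by transfer (simp add: scaleC_scaleC)
  show scale_real: "complex_of_real r *\<^sub>C f = r *\<^sub>R f" for r and f :: "'a \<Rightarrow>\<^sub>L 'b"
    by transfer (simp add: scaleC_of_real)
  have le: "norm (c *\<^sub>C f) \<le> cmod c * norm f" for c and f :: "'a \<Rightarrow>\<^sub>L 'b"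
  proof (rule norm_blinfun_bound)
    fix x
    have "norm (blinfun_apply (c *\<^sub>C f) x) = cmod c * norm (blinfun_apply f x)"
      by transfer (simp add: norm_scaleC)
    also have "\<dots> \<le> cmod c * (norm f * norm x)"
      by (intro mult_left_mono norm_blinfun) simp
    finally show "norm (blinfun_apply (c *\<^sub>C f) x) \<le> cmod c * norm f * norm x"
      by (simp add: mult.assoc)
  qed simp
  show "norm (c *\<^sub>C f) = cmod c * norm f"
  proof (cases "c = 0")
    case True
    then show ?thesis using le[of c f] by simp
  next
    case False
    have "f = inverse c *\<^sub>C (c *\<^sub>C f)"
      using False scale_real[of 1 f] by (simp add: scale2)
    then have "norm f \<le> cmod (inverse c) * norm (c *\<^sub>C f)"
      using le[of "inverse c" "c *\<^sub>C f"] by simp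
    then have "cmod c * norm f \<le> norm (c *\<^sub>C f)"
      using False by (simp add: norm_divide field_simps)
    then show ?thesis using le[of c f] by simp
  qed
qed

end

section \<open>Von Neumann algebras\<close>

text \<open>The library type of bounded operators is only real-linear, so the algebra \<open>B(H)\<close>
  of bounded complex-linear operators is carved out as a subset.\<close>

definition BH :: "('h::complex_hilbert_space \<Rightarrow>\<^sub>L 'h) set"
  where "BH = {A. bounded_clinear (blinfun_apply A)}"

definition adj :: "('h::complex_hilbert_space \<Rightarrow>\<^sub>L 'h) \<Rightarrow> 'h \<Rightarrow>\<^sub>L 'h"
  where "adj A = (THE B. \<forall>\<xi> \<eta>. cinner (blinfun_apply A \<xi>) \<eta> = cinner \<xi> (blinfun_apply B \<eta>))"

definition commutant :: "('h::complex_hilbert_space \<Rightarrow>\<^sub>L 'h) set \<Rightarrow> ('h \<Rightarrow>\<^sub>L 'h) set"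
  where "commutant S = {A \<in> BH. \<forall>B\<in>S. A o\<^sub>L B = B o\<^sub>L A}"

text \<open>A self-adjoint subset of \<open>B(H)\<close> equal to its bicommutant is automatically a
  unital subalgebra.\<close>

definition von_neumann_algebra :: "('h::complex_hilbert_space \<Rightarrow>\<^sub>L 'h) set \<Rightarrow> bool"
  where "von_neumann_algebra M \<longleftrightarrow>
    M \<subseteq> BH \<and> adj ` M \<subseteq> M \<and> commutant (commutant M) = M"

definition op_pos :: "('h::complex_hilbert_space \<Rightarrow>\<^sub>L 'h) \<Rightarrow> bool"
  where "op_pos A \<longleftrightarrow> A \<in> BH \<and> (\<forall>\<xi>. cinner \<xi> (blinfun_apply A \<xi>) \<in> \<real>\<^sub>\<ge>\<^sub>0)"

definition op_le :: "('h::complex_hilbert_space \<Rightarrow>\<^sub>L 'h) \<Rightarrow> ('h \<Rightarrow>\<^sub>L 'h) \<Rightarrow> bool"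
  where "op_le A B \<longleftrightarrow> op_pos (B - A)"

definition op_abs :: "('h::complex_hilbert_space \<Rightarrow>\<^sub>L 'h) \<Rightarrow> 'h \<Rightarrow>\<^sub>L 'h"
  where "op_abs A = (THE B. op_pos B \<and> B o\<^sub>L B = adj A o\<^sub>L A)"

definition self_adjoints :: "('h::complex_hilbert_space \<Rightarrow>\<^sub>L 'h) set \<Rightarrow> ('h \<Rightarrow>\<^sub>L 'h) set"
  where "self_adjoints M = {A \<in> M. adj A = A}"

definition positives :: "('h::complex_hilbert_space \<Rightarrow>\<^sub>L 'h) set \<Rightarrow> ('h \<Rightarrow>\<^sub>L 'h) set"
  where "positives M = {A \<in> M. op_pos A}"

definition projections :: "('h::complex_hilbert_space \<Rightarrow>\<^sub>L 'h) set \<Rightarrow> ('h \<Rightarrow>\<^sub>L 'h) set"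
  where "projections M = {p \<in> M. adj p = p \<and> p o\<^sub>L p = p}"

section \<open>Faithful normal finite traces\<close>

text \<open>A finite trace is given by its linear extension \<open>\<tau>\<close> to the whole of \<open>M\<close>; the values of
  \<open>\<tau>\<close> outside \<open>M\<close> are irrelevant.\<close>

definition finite_trace :: "('h::complex_hilbert_space \<Rightarrow>\<^sub>L 'h) set \<Rightarrow> (('h \<Rightarrow>\<^sub>L 'h) \<Rightarrow> complex) \<Rightarrow> bool"
  where "finite_trace M \<tau> \<longleftrightarrow>
    (\<forall>A\<in>M. \<forall>B\<in>M. \<tau> (A + B) = \<tau> A + \<tau> B) \<and>
    (\<forall>c. \<forall>A\<in>M. \<tau> (c *\<^sub>C A) = c * \<tau> A) \<and>
    (\<forall>A\<in>positives M. \<tau> A \<in> \<real>\<^sub>\<ge>\<^sub>0) \<and>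
    (\<forall>A\<in>M. \<forall>B\<in>M. \<tau> (A o\<^sub>L B) = \<tau> (B o\<^sub>L A))"

definition faithful_trace :: "('h::complex_hilbert_space \<Rightarrow>\<^sub>L 'h) set \<Rightarrow> (('h \<Rightarrow>\<^sub>L 'h) \<Rightarrow> complex) \<Rightarrow> bool"
  where "faithful_trace M \<tau> \<longleftrightarrow> (\<forall>A\<in>positives M. \<tau> A = 0 \<longrightarrow> A = 0)"

definition op_lub :: "('h::complex_hilbert_space \<Rightarrow>\<^sub>L 'h) set \<Rightarrow> ('h \<Rightarrow>\<^sub>L 'h) set \<Rightarrow> ('h \<Rightarrow>\<^sub>L 'h) \<Rightarrow> bool"
  where "op_lub M D s \<longleftrightarrow> s \<in> self_adjoints M \<and> (\<forall>A\<in>D. op_le A s) \<and>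
    (\<forall>u\<in>self_adjoints M. (\<forall>A\<in>D. op_le A u) \<longrightarrow> op_le s u)"

text \<open>Normality: \<open>\<tau> (sup D) = sup (\<tau> ` D)\<close> for upward directed sets \<open>D\<close> of positive
  elements having a supremum (equivalently, for bounded increasing nets).\<close>

definition normal_trace :: "('h::complex_hilbert_space \<Rightarrow>\<^sub>L 'h) set \<Rightarrow> (('h \<Rightarrow>\<^sub>L 'h) \<Rightarrow> complex) \<Rightarrow> bool"
  where "normal_trace M \<tau> \<longleftrightarrow>
    (\<forall>D s. D \<subseteq> positives M \<and> D \<noteq> {} \<and>
       (\<forall>A\<in>D. \<forall>B\<in>D. \<exists>C\<in>D. op_le A C \<and> op_le B C) \<and> op_lub M D s
       \<longrightarrow> Re (\<tau> s) = (SUP A\<in>D. Re (\<tau> A)))"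

section \<open>The noncommutative \<open>L\<^sup>1\<close> space\<close>

text \<open>\<open>L1_completion M \<tau> \<iota>\<close>: the Banach space \<open>'l\<close> together with the embedding
  \<open>\<iota> : M \<rightarrow> 'l\<close> is a completion of \<open>M\<close> for the norm \<open>\<tau> |x|\<close>. Only the restriction of \<open>\<iota>\<close> to
  \<open>M\<close> matters. Completions being unique up to isometric isomorphism,
  results are stated for an arbitrary one.\<close>

definition L1_completion :: "('h::complex_hilbert_space \<Rightarrow>\<^sub>L 'h) set \<Rightarrow> (('h \<Rightarrow>\<^sub>L 'h) \<Rightarrow> complex)
    \<Rightarrow> (('h \<Rightarrow>\<^sub>L 'h) \<Rightarrow> 'l::complex_banach) \<Rightarrow> bool"
  where "L1_completion M \<tau> \<iota> \<longleftrightarrow>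
    (\<forall>A\<in>M. \<forall>B\<in>M. \<iota> (A + B) = \<iota> A + \<iota> B) \<and>
    (\<forall>c. \<forall>A\<in>M. \<iota> (c *\<^sub>C A) = c *\<^sub>C \<iota> A) \<and>
    (\<forall>A\<in>M. norm (\<iota> A) = Re (\<tau> (op_abs A))) \<and>
    closure (\<iota> ` M) = UNIV"

definition L1_sa :: "('h::complex_hilbert_space \<Rightarrow>\<^sub>L 'h) set
    \<Rightarrow> (('h \<Rightarrow>\<^sub>L 'h) \<Rightarrow> 'l::complex_banach) \<Rightarrow> 'l set"
  where "L1_sa M \<iota> = closure (\<iota> ` self_adjoints M)"

definition L1_pos :: "('h::complex_hilbert_space \<Rightarrow>\<^sub>L 'h) set
    \<Rightarrow> (('h \<Rightarrow>\<^sub>L 'h) \<Rightarrow> 'l::complex_banach) \<Rightarrow> 'l set"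
  where "L1_pos M \<iota> = closure (\<iota> ` positives M)"

text \<open>Extension by continuity: the limit of \<open>f A\<close> as \<open>A \<in> M\<close> and \<open>\<iota> A \<rightarrow> z\<close>. It is
  used for the trace and for left multiplication by elements of \<open>M\<close>, which are bounded for
  the \<open>L\<^sup>1\<close> norm.\<close>

definition L1_extend :: "('h::complex_hilbert_space \<Rightarrow>\<^sub>L 'h) set
    \<Rightarrow> (('h \<Rightarrow>\<^sub>L 'h) \<Rightarrow> 'l::complex_banach) \<Rightarrow> (('h \<Rightarrow>\<^sub>L 'h) \<Rightarrow> 'c::t2_space) \<Rightarrow> 'l \<Rightarrow> 'c"
  where "L1_extend M \<iota> f z = Lim (inf (filtercomap \<iota> (nhds z)) (principal M)) f"

definition L1_trace :: "('h::complex_hilbert_space \<Rightarrow>\<^sub>L 'h) set \<Rightarrow> (('h \<Rightarrow>\<^sub>L 'h) \<Rightarrow> complex)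
    \<Rightarrow> (('h \<Rightarrow>\<^sub>L 'h) \<Rightarrow> 'l::complex_banach) \<Rightarrow> 'l \<Rightarrow> complex"
  where "L1_trace M \<tau> \<iota> = L1_extend M \<iota> \<tau>"

definition L1_lmult :: "('h::complex_hilbert_space \<Rightarrow>\<^sub>L 'h) set
    \<Rightarrow> (('h \<Rightarrow>\<^sub>L 'h) \<Rightarrow> 'l::complex_banach) \<Rightarrow> ('h \<Rightarrow>\<^sub>L 'h) \<Rightarrow> 'l \<Rightarrow> 'l"
  where "L1_lmult M \<iota> p = L1_extend M \<iota> (\<lambda>A. \<iota> (p o\<^sub>L A))"

definition positive_contraction :: "('h::complex_hilbert_space \<Rightarrow>\<^sub>L 'h) set
    \<Rightarrow> (('h \<Rightarrow>\<^sub>L 'h) \<Rightarrow> 'l::complex_banach) \<Rightarrow> ('l \<Rightarrow> 'l) \<Rightarrow> bool"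
  where "positive_contraction M \<iota> T \<longleftrightarrow>
    bounded_clinear T \<and>
    (\<forall>x\<in>L1_pos M \<iota>. T x \<in> L1_pos M \<iota>) \<and>
    (\<forall>x\<in>L1_sa M \<iota>. norm (T x) \<le> norm x)"

text \<open>The trace \<open>\<tau>(p T\<^sup>n x)\<close> below is a nonnegative real number, as \<open>T\<^sup>n x \<ge> 0\<close>.\<close>

definition smoothing :: "('h::complex_hilbert_space \<Rightarrow>\<^sub>L 'h) set \<Rightarrow> (('h \<Rightarrow>\<^sub>L 'h) \<Rightarrow> complex)
    \<Rightarrow> (('h \<Rightarrow>\<^sub>L 'h) \<Rightarrow> 'l::complex_banach) \<Rightarrow> ('l \<Rightarrow> 'l) \<Rightarrow> 'l \<Rightarrow> bool"
  where "smoothing M \<tau> \<iota> T x \<longleftrightarrow>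
    x \<in> L1_pos M \<iota> \<and> x \<noteq> 0 \<and>
    (\<forall>\<epsilon>>0. \<exists>\<delta>>0. \<exists>n\<^sub>0. \<forall>p\<in>projections M. Re (\<tau> p) < \<delta> \<longrightarrow>
      (\<forall>n\<ge>n\<^sub>0. Re (L1_trace M \<tau> \<iota> (L1_lmult M \<iota> p ((T ^^ n) x))) < \<epsilon>))"

end

theory Submission
  imports Defs
begin

text \<open>
  If the norms \<open>\<parallel>T\<^sup>n y\<parallel>\<close> decrease to \<open>c > 0\<close>, let \<open>C\<^sub>k\<close> be the set of convex combinations \<open>a\<close> of
  the \<open>T\<^sup>j y\<close>, \<open>j \<ge> k\<close>, with \<open>\<parallel>T a - a\<parallel> \<le> 1 / (k + 1)\<close>; Cesaro means show that it is nonempty. The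
  norm is additive on the positive cone, so \<open>\<parallel>a\<parallel> \<ge> c\<close> on \<open>C\<^sub>k\<close>, and a point common to the closures
  of the \<open>C\<^sub>k\<close> is a nonzero positive fixed point. Weak compactness is replaced by a Hilbert space
  argument: smoothing and a spectral cut-off approximate the orbit in \<open>L\<^sup>1\<close>, up to any \<open>\<epsilon>\<close>, by
  elements of \<open>M\<close> with bounded \<open>\<tau> (u\<^sup>* u)\<close>, and by the parallelogram law the approximants with
  nearly minimal \<open>\<tau> (u\<^sup>* u)\<close> are close together.
\<close>

section \<open>Nested convex sets\<close>

text \<open>\<open>L\<^sup>1\<close> enters only as an abstract completion of \<open>M\<close>, so
  every fact about it is pulled back to norm-convergent computations inside \<open>M\<close>. The
  Hilbert space argument applies because the trace is finite:
  \<open>(norm (\<iota> u))\<^sup>2\<close> is at most \<open>\<tau> id_blinfun\<close> times the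
  trace of \<open>adj u o\<^sub>L u\<close>, so closeness in the quadratic form forces closeness in
  \<open>L\<^sup>1\<close>. The sets are convex because the parallelogram law tests midpoints, and
  they start at the index \<open>k\<close> because smoothing controls only late iterates. To read
  the smoothing condition on elements of \<open>M\<close>, the trace and left multiplication by a
  projection must extend continuously. For the trace this rests on equality of the norms of
  \<open>\<iota> A\<close> and \<open>\<iota> (adj A)\<close>; it comes from comparing traces along
  a square root iteration, in place of a polar decomposition. The spectral cut-off is a kernel
  projection, in place of a functional calculus. The nested-set argument serves a second time, for
  orthogonal decompositions in the underlying Hilbert space, and thus for the existence of
  adjoints.\<close>

lemma norm_convex_combination_diff_le:
  fixes V :: "'w::real_vector set" and j :: "'w \<Rightarrow> 'l::real_normed_vector"
  assumes V: "subspace V"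
    and j_add: "\<And>u v. u \<in> V \<Longrightarrow> v \<in> V \<Longrightarrow> j (u + v) = j u + j v"
    and j_scale: "\<And>r u. u \<in> V \<Longrightarrow> j (r *\<^sub>R u) = r *\<^sub>R j u"
    and uv: "u \<in> V" "v \<in> V" "norm (a - j u) \<le> \<delta>" "norm (b - j v) \<le> \<delta>" "0 \<le> t" "t \<le> 1"
  shows "norm (((1 - t) *\<^sub>R a + t *\<^sub>R b) - j ((1 - t) *\<^sub>R u + t *\<^sub>R v)) \<le> \<delta>"
proof -
  have "((1 - t) *\<^sub>R a + t *\<^sub>R b) - j ((1 - t) *\<^sub>R u + t *\<^sub>R v)
      = ((1 - t) *\<^sub>R a + t *\<^sub>R b) - ((1 - t) *\<^sub>R j u + t *\<^sub>R j v)"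
    using uv V by (simp only: j_add j_scale subspace_scale)
  also have "\<dots> = (1 - t) *\<^sub>R (a - j u) + t *\<^sub>R (b - j v)" by (simp add: algebra_simps)
  also have "norm \<dots> \<le> (1 - t) * norm (a - j u) + t * norm (b - j v)"
    using uv by (intro order_trans[OF norm_triangle_ineq]) simp
  also have "\<dots> \<le> (1 - t) * \<delta> + t * \<delta>"
    using uv by (intro add_mono mult_left_mono) auto
  also have "\<dots> = \<delta>" by (simp add: field_simps)
  finally show ?thesis .
qed

text \<open>The correction term \<open>t * (1 - t) * q (u - v)\<close> is nonnegative, so
  \<open>q\<close> is convex on \<open>V\<close>. In the main argument this carries the bound from
  the orbit to its convex hull.\<close>

lemma convex_approximable:
  fixes V :: "'w::real_vector set" and j :: "'w \<Rightarrow> 'l::real_normed_vector" and q :: "'w \<Rightarrow> real"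
  assumes V: "subspace V"
    and j_add: "\<And>u v. u \<in> V \<Longrightarrow> v \<in> V \<Longrightarrow> j (u + v) = j u + j v"
    and j_scale: "\<And>r u. u \<in> V \<Longrightarrow> j (r *\<^sub>R u) = r *\<^sub>R j u"
    and q_nonneg: "\<And>u. u \<in> V \<Longrightarrow> 0 \<le> q u"
    and q_conv: "\<And>u v t. u \<in> V \<Longrightarrow> v \<in> V \<Longrightarrow> 0 \<le> t \<Longrightarrow> t \<le> 1 \<Longrightarrow>
      q ((1 - t) *\<^sub>R u + t *\<^sub>R v) = (1 - t) * q u + t * q v - t * (1 - t) * q (u - v)"
  shows "convex {a. \<exists>u\<in>V. norm (a - j u) \<le> \<delta> \<and> q u \<le> B}"
  unfolding convex_alt
proof (intro ballI allI impI)
  fix a b t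
  assume ab: "a \<in> {a. \<exists>u\<in>V. norm (a - j u) \<le> \<delta> \<and> q u \<le> B}"
    "b \<in> {a. \<exists>u\<in>V. norm (a - j u) \<le> \<delta> \<and> q u \<le> B}" and "0 \<le> t \<and> t \<le> (1::real)"
  then have t: "0 \<le> t" "t \<le> 1" by auto
  obtain u v where u: "u \<in> V" "norm (a - j u) \<le> \<delta>" "q u \<le> B"
    and v: "v \<in> V" "norm (b - j v) \<le> \<delta>" "q v \<le> B"
    using ab by auto
  have "q ((1 - t) *\<^sub>R u + t *\<^sub>R v) \<le> (1 - t) * q u + t * q v"
    using q_conv[OF u(1) v(1) t] q_nonneg[OF subspace_diff[OF V u(1) v(1)]] t by simp
  also have "\<dots> \<le> (1 - t) * B + t * B"
    using t u v by (intro add_mono mult_left_mono) auto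
  also have "\<dots> = B" by (simp add: algebra_simps)
  finally have "q ((1 - t) *\<^sub>R u + t *\<^sub>R v) \<le> B" .
  moreover have "(1 - t) *\<^sub>R u + t *\<^sub>R v \<in> V"
    using V u v by (simp add: subspace_add subspace_scale)
  ultimately show "(1 - t) *\<^sub>R a + t *\<^sub>R b \<in> {a. \<exists>u\<in>V. norm (a - j u) \<le> \<delta> \<and> q u \<le> B}"
    using norm_convex_combination_diff_le[OF V j_add j_scale u(1) v(1) u(2) v(2) t] by blast
qed

text \<open>\<open>q_conv\<close> is the parallelogram law: two approximants of nearly minimal
  \<open>q\<close> are close, as otherwise their midpoint would fall below the infimum. Linearity of
  \<open>j\<close> is asked only on \<open>V\<close> because \<open>\<iota>\<close> is constrained
  only on \<open>M\<close>.\<close>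

lemma nested_convex_shrink:
  fixes D :: "nat \<Rightarrow> 'l::real_normed_vector set" and V :: "'w::real_vector set"
    and q :: "'w \<Rightarrow> real" and j :: "'w \<Rightarrow> 'l"
  assumes V: "subspace V"
    and j_add: "\<And>u v. u \<in> V \<Longrightarrow> v \<in> V \<Longrightarrow> j (u + v) = j u + j v"
    and j_scale: "\<And>r u. u \<in> V \<Longrightarrow> j (r *\<^sub>R u) = r *\<^sub>R j u"
    and q_nonneg: "\<And>u. u \<in> V \<Longrightarrow> 0 \<le> q u"
    and q_conv: "\<And>u v t. u \<in> V \<Longrightarrow> v \<in> V \<Longrightarrow> 0 \<le> t \<Longrightarrow> t \<le> 1 \<Longrightarrow>
      q ((1 - t) *\<^sub>R u + t *\<^sub>R v) = (1 - t) * q u + t * q v - t * (1 - t) * q (u - v)"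
    and jq: "\<And>u. u \<in> V \<Longrightarrow> (norm (j u))\<^sup>2 \<le> c * q u"
    and D_convex: "\<And>k. convex (D k)" and D_ne: "\<And>k. D k \<noteq> {}" and D_dec: "decseq D"
    and approx: "\<And>\<epsilon>. \<epsilon> > 0 \<Longrightarrow>
      \<exists>B k. \<forall>a\<in>D k. \<exists>u\<in>V. norm (a - j u) \<le> \<epsilon> \<and> q u \<le> B"
    and e: "\<epsilon> > 0"
  shows "\<exists>E k. (\<forall>k. convex (E k) \<and> E k \<noteq> {} \<and> E k \<subseteq> D k) \<and> decseq E \<and>
    (\<forall>a\<in>E k. \<forall>b\<in>E k. norm (a - b) \<le> \<epsilon>)"
proof -
  \<comment> \<open>Chosen so that \<open>q (u - v) \<le> 8 * \<eta>\<close> gives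
    \<open>norm (j (u - v)) \<le> \<epsilon> / 2\<close>; two approximation errors of
    \<open>\<epsilon> / 4\<close> complete \<open>\<epsilon>\<close>. The term
    \<open>\<bar>c\<bar> + 1\<close> keeps the denominator positive.\<close>
  define \<eta> where "\<eta> = \<epsilon>\<^sup>2 / (32 * (\<bar>c\<bar> + 1))"
  have eta: "\<eta> > 0" using e by (simp add: \<eta>_def add_nonneg_pos)
  have ceta: "c * (8 * \<eta>) \<le> (\<epsilon> / 2)\<^sup>2"
  proof -
    have "c * (8 * \<eta>) \<le> (\<bar>c\<bar> + 1) * (8 * \<eta>)"
      using eta by (intro mult_right_mono) auto
    also have "\<dots> = (\<epsilon> / 2)\<^sup>2"
      unfolding \<eta>_def by (simp add: field_simps power2_eq_square add_nonneg_eq_0_iff)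
    finally show ?thesis .
  qed
  obtain B k0 where Bk: "\<And>a. a \<in> D k0 \<Longrightarrow> \<exists>u\<in>V. norm (a - j u) \<le> \<epsilon> / 4 \<and> q u \<le> B"
    using approx[of "\<epsilon> / 4"] e by auto
  define U where "U k = {u \<in> V. \<exists>a\<in>D k. norm (a - j u) \<le> \<epsilon> / 4}" for k
  define m where "m k = Inf (q ` U k)" for k
  have Dle: "D l \<subseteq> D k" if "k \<le> l" for k l
    using D_dec that by (auto simp: decseq_def)
  have bdd: "bdd_below (q ` U k)" for k
    using q_nonneg by (intro bdd_belowI[of _ 0]) (auto simp: U_def)
  have small: "\<exists>u\<in>U k. q u \<le> B" for k
  proof -
    obtain a where a: "a \<in> D (max k k0)" using D_ne by blast
    then have "a \<in> D k0" "a \<in> D k" using Dle[of k0 "max k k0"] Dle[of k "max k k0"] by auto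
    then show ?thesis using Bk[of a] by (auto simp: U_def)
  qed
  have Une: "U k \<noteq> {}" for k using small[of k] by blast
  have mB: "m k \<le> B" for k
    using small[of k] bdd[of k] unfolding m_def by (meson cINF_lower order_trans)
  then have bddm: "bdd_above (range m)" unfolding bdd_above_def by blast
  define s where "s = Sup (range m)"
  have ms: "m k \<le> s" for k unfolding s_def using bddm by (intro cSup_upper) auto
  obtain k1 where k1: "s - \<eta> < m k1"
  proof -
    have "s - \<eta> < Sup (range m)" using eta by (simp add: s_def)
    then show ?thesis using that bddm by (subst (asm) less_cSup_iff) auto
  qed
  \<comment> \<open>The threshold does not depend on \<open>k\<close>, which makes \<open>E\<close>
    decreasing, and \<open>m k \<le> s\<close> makes each \<open>E k\<close> nonempty. At
    \<open>k1\<close> the infimum exceeds \<open>s - \<eta>\<close>, so the chosen approximants have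
    \<open>q\<close> pinned to an interval of length \<open>2 * \<eta>\<close>.\<close>
  define E where "E k = {a \<in> D k. \<exists>u\<in>V. norm (a - j u) \<le> \<epsilon> / 4 \<and> q u \<le> s + \<eta>}" for k
  have mid: "norm (((1 - t) *\<^sub>R a + t *\<^sub>R b) - j ((1 - t) *\<^sub>R u + t *\<^sub>R v)) \<le> \<epsilon> / 4"
    if "u \<in> V" "v \<in> V" "norm (a - j u) \<le> \<epsilon> / 4" "norm (b - j v) \<le> \<epsilon> / 4" "0 \<le> t" "t \<le> 1"
    for t u v a b
    by (rule norm_convex_combination_diff_le[OF V j_add j_scale that])
  have Vmid: "(1 - t) *\<^sub>R u + t *\<^sub>R v \<in> V" if "u \<in> V" "v \<in> V" for t u v
    using V that by (simp add: subspace_add subspace_scale)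
  have Vdiff: "u - v \<in> V" if "u \<in> V" "v \<in> V" for u v
    using V that by (simp add: subspace_diff)
  have "convex (E k)" for k
  proof -
    have "E k = D k \<inter> {a. \<exists>u\<in>V. norm (a - j u) \<le> \<epsilon> / 4 \<and> q u \<le> s + \<eta>}"
      by (auto simp: E_def)
    moreover have "convex {a. \<exists>u\<in>V. norm (a - j u) \<le> \<epsilon> / 4 \<and> q u \<le> s + \<eta>}"
      by (rule convex_approximable[OF V j_add j_scale q_nonneg q_conv])
    ultimately show ?thesis using D_convex by (simp only: convex_Int)
  qed
  moreover have "E k \<noteq> {}" for k
  proof -
    have "Inf (q ` U k) < s + \<eta>" using ms[of k] eta by (simp add: m_def)
    then obtain u where "u \<in> U k" "q u < s + \<eta>"
      using Une bdd by (subst (asm) cInf_less_iff) auto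
    then show ?thesis by (auto simp: U_def E_def intro: less_imp_le)
  qed
  moreover have "E k \<subseteq> D k" for k by (auto simp: E_def)
  moreover have "decseq E"
    using Dle by (fastforce simp: decseq_def E_def)
  moreover have "norm (a - b) \<le> \<epsilon>" if ab: "a \<in> E k1" "b \<in> E k1" for a b
  proof -
    obtain u v where u: "u \<in> V" "norm (a - j u) \<le> \<epsilon> / 4" "q u \<le> s + \<eta>"
      and v: "v \<in> V" "norm (b - j v) \<le> \<epsilon> / 4" "q v \<le> s + \<eta>"
      using ab by (auto simp: E_def)
    let ?w = "(1 - 1/2) *\<^sub>R u + (1/2) *\<^sub>R v"
    have "(1 - 1/2) *\<^sub>R a + (1/2::real) *\<^sub>R b \<in> D k1"
      using D_convex[of k1, unfolded convex_alt, rule_format, of a b "1/2"] ab by (auto simp: E_def)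
    then have "?w \<in> U k1"
      using mid[OF u(1) v(1) u(2) v(2), of "1/2"] Vmid[OF u(1) v(1), of "1/2"] by (auto simp: U_def)
    then have "m k1 \<le> q ?w" unfolding m_def using bdd by (intro cINF_lower) auto
    then have "s - \<eta> < q ?w" using k1 by simp
    \<comment> \<open>The midpoint identity reads
      \<open>q (u - v) / 4 = (q u + q v) / 2 - q ?w\<close>, and the right side is below
      \<open>2 * \<eta>\<close>.\<close>
    then have "q (u - v) \<le> 8 * \<eta>"
      using q_conv[OF u(1) v(1), of "1/2"] u(3) v(3) by simp
    moreover have c0: "c * q (u - v) \<le> c * (8 * \<eta>)" if "c \<ge> 0"
      using calculation that by (intro mult_left_mono)
    moreover have "c * q (u - v) \<le> 0" if "c < 0"
      using that q_nonneg[OF Vdiff[OF u(1) v(1)]] by (simp add: mult_nonpos_nonneg)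
    ultimately have "c * q (u - v) \<le> (\<epsilon> / 2)\<^sup>2"
      using ceta by (smt (verit) zero_le_power2)
    then have "(norm (j (u - v)))\<^sup>2 \<le> (\<epsilon> / 2)\<^sup>2"
      using jq[OF Vdiff[OF u(1) v(1)]] by simp
    then have n1: "norm (j (u - v)) \<le> \<epsilon> / 2"
      using e by (simp add: power2_le_iff_abs_le)
    have "j (u - v) = j u - j v"
      using j_add[of "u - v" v] Vdiff u v by (simp add: algebra_simps)
    then have "a - b = (a - j u) + j (u - v) - (b - j v)" by simp
    then have "norm (a - b) = norm ((a - j u) + j (u - v) - (b - j v))" by (rule arg_cong)
    then have "norm (a - b) \<le> norm (a - j u) + norm (j (u - v)) + norm (b - j v)"
      using norm_triangle_ineq4[of "(a - j u) + j (u - v)" "b - j v"]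
        norm_triangle_ineq[of "a - j u" "j (u - v)"] by linarith
    then show ?thesis using u(2) v(2) n1 by simp
  qed
  ultimately have "(\<forall>k. convex (E k) \<and> E k \<noteq> {} \<and> E k \<subseteq> D k) \<and> decseq E \<and>
    (\<forall>a\<in>E k1. \<forall>b\<in>E k1. norm (a - b) \<le> \<epsilon>)"
    by simp
  then show ?thesis by (intro exI[of _ E] exI[of _ k1])
qed

text \<open>Completeness does the work of compactness: shrinking repeatedly with tolerance
  \<open>1 / (n + 1)\<close> and picking points diagonally gives a Cauchy sequence. Each stage
  replaces the whole decreasing family, since diameters become small only from some index on and the
  next stage needs a family again.\<close>

lemma nested_convex_common_point:
  fixes C :: "nat \<Rightarrow> 'l::banach set" and V :: "'w::real_vector set"
    and q :: "'w \<Rightarrow> real" and j :: "'w \<Rightarrow> 'l"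
  assumes V: "subspace V"
    and j_add: "\<And>u v. u \<in> V \<Longrightarrow> v \<in> V \<Longrightarrow> j (u + v) = j u + j v"
    and j_scale: "\<And>r u. u \<in> V \<Longrightarrow> j (r *\<^sub>R u) = r *\<^sub>R j u"
    and q_nonneg: "\<And>u. u \<in> V \<Longrightarrow> 0 \<le> q u"
    and q_conv: "\<And>u v t. u \<in> V \<Longrightarrow> v \<in> V \<Longrightarrow> 0 \<le> t \<Longrightarrow> t \<le> 1 \<Longrightarrow>
      q ((1 - t) *\<^sub>R u + t *\<^sub>R v) = (1 - t) * q u + t * q v - t * (1 - t) * q (u - v)"
    and jq: "\<And>u. u \<in> V \<Longrightarrow> (norm (j u))\<^sup>2 \<le> c * q u"
    and C_convex: "\<And>k. convex (C k)" and C_ne: "\<And>k. C k \<noteq> {}" and C_dec: "decseq C"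
    and approx: "\<And>\<epsilon>. \<epsilon> > 0 \<Longrightarrow>
      \<exists>B k. \<forall>a\<in>C k. \<exists>u\<in>V. norm (a - j u) \<le> \<epsilon> \<and> q u \<le> B"
  obtains z where "\<And>k. z \<in> closure (C k)"
proof -
  define P where "P D \<longleftrightarrow> (\<forall>k. convex (D k) \<and> D k \<noteq> {} \<and> D k \<subseteq> C k) \<and> decseq D" for D
  have step: "\<exists>E. P E \<and> (\<forall>k. E k \<subseteq> D k) \<and> (\<exists>k. \<forall>a\<in>E k. \<forall>b\<in>E k. norm (a - b) \<le> \<epsilon>)"
    if D: "P D" and e: "\<epsilon> > 0" for D and \<epsilon> :: real
  proof -
    have *: "\<exists>B k. \<forall>a\<in>D k. \<exists>u\<in>V. norm (a - j u) \<le> \<delta> \<and> q u \<le> B" if "\<delta> > 0" for \<delta>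
      using approx[OF that] D unfolding P_def by (meson subsetD)
    have "\<exists>E k. (\<forall>k. convex (E k) \<and> E k \<noteq> {} \<and> E k \<subseteq> D k) \<and> decseq E \<and>
        (\<forall>a\<in>E k. \<forall>b\<in>E k. norm (a - b) \<le> \<epsilon>)"
      using D by (intro nested_convex_shrink[OF V j_add j_scale q_nonneg q_conv jq _ _ _ * e])
        (auto simp: P_def)
    then obtain E k where E: "\<And>k. convex (E k)" "\<And>k. E k \<noteq> {}" "\<And>k. E k \<subseteq> D k" "decseq E"
      "\<forall>a\<in>E k. \<forall>b\<in>E k. norm (a - b) \<le> \<epsilon>" by auto
    have "E k \<subseteq> C k" for k
      using E(3)[of k] D by (auto simp: P_def)
    with E have "P E" by (simp add: P_def)
    with E show ?thesis by blast
  qed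
  define Q where "Q n D E \<longleftrightarrow> (\<forall>k. E k \<subseteq> D k) \<and>
    (\<exists>k. \<forall>a\<in>E k. \<forall>b\<in>E k. norm (a - b) \<le> 1 / real (Suc n))" for n and D E :: "nat \<Rightarrow> 'l set"
  have "P C" using C_convex C_ne C_dec by (simp add: P_def)
  then have base: "\<exists>D. P D" by blast
  have step': "\<exists>E. P E \<and> Q n D E" if "P D" for D n
    using step[OF that, of "1 / real (Suc n)"] by (simp add: Q_def)
  obtain F where FP: "\<And>n. P (F n)" and FQ: "\<And>n. Q n (F n) (F (Suc n))"
    using dependent_nat_choice[of "\<lambda>_. P" Q, OF base step'] by blast
  have Fsub: "F (Suc n) k \<subseteq> F n k" for n k using FQ[of n] by (simp add: Q_def)
  have Fd: "\<exists>k. \<forall>a\<in>F (Suc n) k. \<forall>b\<in>F (Suc n) k. norm (a - b) \<le> 1 / real (Suc n)" for n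
    using FQ[of n] by (simp add: Q_def)
  obtain \<kappa> where \<kappa>: "\<And>n a b. a \<in> F (Suc n) (\<kappa> n) \<Longrightarrow> b \<in> F (Suc n) (\<kappa> n) \<Longrightarrow>
      norm (a - b) \<le> 1 / real (Suc n)"
    using Fd by metis
  \<comment> \<open>\<open>K n\<close> dominates \<open>n\<close> and every
    \<open>\<kappa> i\<close> with \<open>i \<le> n\<close>. Hence \<open>a m\<close> lies in the
    small sets of all stages up to \<open>m\<close>, and in \<open>C k\<close> as soon as
    \<open>m \<ge> k\<close>.\<close>
  define K where "K n = n + (\<Sum>i\<le>n. \<kappa> i)" for n
  have F_anti: "F n' k' \<subseteq> F n k" if "n \<le> n'" "k \<le> k'" for n n' k k'
  proof -
    have "F n' k' \<subseteq> F n' k" using FP[of n'] that by (auto simp: P_def decseq_def)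
    also have "\<dots> \<subseteq> F n k"
      using lift_Suc_antimono_le[of "\<lambda>n. F n k" n n'] Fsub that by blast
    finally show ?thesis .
  qed
  have "\<exists>a. a \<in> F (Suc n) (K n)" for n using FP[of "Suc n"] by (auto simp: P_def)
  then obtain a where a: "\<And>n. a n \<in> F (Suc n) (K n)" by metis
  have \<kappa>K: "\<kappa> n \<le> K m" if "n \<le> m" for n m
    unfolding K_def using that member_le_sum[of n "{..m}" \<kappa>] by auto
  have a_in: "a m \<in> F (Suc n) (\<kappa> n)" if "n \<le> m" for n m
    using a[of m] F_anti[of "Suc n" "Suc m" "\<kappa> n" "K m"] \<kappa>K[OF that] that by auto
  have "Cauchy a"
  proof (rule metric_CauchyI)
    fix e :: real assume "e > 0"
    then obtain n where n: "1 / real (Suc n) < e" using nat_approx_posE by blast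
    have "dist (a m) (a m') < e" if "m \<ge> n" "m' \<ge> n" for m m'
      using \<kappa>[OF a_in[OF that(1)] a_in[OF that(2)]] n by (simp add: dist_norm)
    then show "\<exists>M. \<forall>m\<ge>M. \<forall>n\<ge>M. dist (a m) (a n) < e" by blast
  qed
  then obtain z where z: "a \<longlonglongrightarrow> z" using Cauchy_convergent convergent_def by blast
  have "z \<in> closure (C k)" for k
  proof (rule Lim_in_closed_set[OF closed_closure _ _ z])
    have "a n \<in> C k" if "n \<ge> k" for n
    proof -
      have "a n \<in> C (K n)" using a[of n] FP[of "Suc n"] by (auto simp: P_def)
      moreover have "k \<le> K n" using that by (simp add: K_def)
      ultimately show ?thesis using C_dec by (auto simp: decseq_def)
    qed
    then show "\<forall>\<^sub>F n in sequentially. a n \<in> closure (C k)"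
      using closure_subset by (intro eventually_sequentiallyI[of k]) blast
  qed simp
  then show ?thesis using that by blast
qed

section \<open>Complex Hilbert spaces\<close>

lemma scaleC_zero_right [simp]: "c *\<^sub>C (0::'a::complex_normed_vector) = 0"
  using linear_0[OF bounded_linear.linear[OF bounded_linear_scaleC_right]] .

lemma scaleC_diff_right: "c *\<^sub>C (x - y) = c *\<^sub>C x - c *\<^sub>C (y::'a::complex_normed_vector)"
  using linear_diff[OF bounded_linear.linear[OF bounded_linear_scaleC_right]] .

lemma scaleC_one [simp]: "1 *\<^sub>C (x::'a::complex_normed_vector) = x"
  using scaleC_of_real[of 1 x] by simp

lemma scaleC_uminus_one [simp]: "(- 1) *\<^sub>C (x::'a::complex_normed_vector) = - x"
  using scaleC_of_real[of "- 1" x] by simp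

lemma scaleC_minus_left: "(- c) *\<^sub>C x = - (c *\<^sub>C (x::'a::complex_normed_vector))"
  by (metis mult_minus1 scaleC_scaleC scaleC_uminus_one)

lemma cinner_add_left: "cinner (x + y) (z::'a::complex_hilbert_space) = cinner x z + cinner y z"
  by (metis cinner_add_right cinner_commute complex_cnj_add)

lemma cinner_scaleC_left: "cinner (c *\<^sub>C x) (y::'a::complex_hilbert_space) = cnj c * cinner x y"
  by (metis cinner_scaleC_right cinner_commute complex_cnj_mult)

lemma cinner_scaleR_right: "cinner x (r *\<^sub>R (y::'a::complex_hilbert_space)) = of_real r * cinner x y"
  by (metis cinner_scaleC_right scaleC_of_real)

lemma cinner_scaleR_left: "cinner (r *\<^sub>R x) (y::'a::complex_hilbert_space) = of_real r * cinner x y"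
  by (metis cinner_scaleC_left scaleC_of_real complex_cnj_complex_of_real)

lemma cinner_minus_right: "cinner x (- (y::'a::complex_hilbert_space)) = - cinner x y"
  using cinner_scaleR_right[of x "- 1" y] by simp

lemma cinner_minus_left: "cinner (- x) (y::'a::complex_hilbert_space) = - cinner x y"
  using cinner_scaleR_left[of "- 1" x y] by simp

lemma cinner_diff_right: "cinner x (y - (z::'a::complex_hilbert_space)) = cinner x y - cinner x z"
  using cinner_add_right[of x y "- z"] by (simp add: cinner_minus_right)

lemma cinner_diff_left: "cinner (x - y) (z::'a::complex_hilbert_space) = cinner x z - cinner y z"
  using cinner_add_left[of x "- y" z] by (simp add: cinner_minus_left)

lemma cinner_zero_right [simp]: "cinner x (0::'a::complex_hilbert_space) = 0"
  using cinner_scaleR_right[of x 0 0] by simp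

lemma cinner_zero_left [simp]: "cinner (0::'a::complex_hilbert_space) x = 0"
  using cinner_scaleR_left[of 0 0 x] by simp

lemmas cinner_simps = cinner_add_left cinner_add_right cinner_diff_left cinner_diff_right
  cinner_scaleC_left cinner_scaleC_right cinner_scaleR_left cinner_scaleR_right
  cinner_minus_left cinner_minus_right

lemma cinner_self: "cinner x (x::'a::complex_hilbert_space) = of_real ((norm x)\<^sup>2)"
  using cinner_ge_zero[of x] norm_eq_sqrt_cinner[of x]
  by (simp add: complex_nonneg_Reals_iff complex_eq_iff)

lemma power2_norm_cinner: "(norm (x::'a::complex_hilbert_space))\<^sup>2 = Re (cinner x x)"
  by (simp add: cinner_self)

lemma Re_cinner_commute: "Re (cinner x (y::'a::complex_hilbert_space)) = Re (cinner y x)"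
  by (subst cinner_commute) simp

lemma cinner_ext:
  assumes "\<And>z. cinner z x = cinner z (y::'a::complex_hilbert_space)"
  shows "x = y"
proof -
  have "cinner (x - y) (x - y) = 0" using assms by (simp add: cinner_diff_right)
  then show ?thesis by (simp add: cinner_eq_zero_iff)
qed

text \<open>Pythagoras for the component of \<open>t\<close> orthogonal to \<open>r\<close>.
  Nonnegativity of the left side is Cauchy-Schwarz; later the formula turns minimality of a distance
  into orthogonality.\<close>

lemma orthogonal_residual_norm:
  fixes t r :: "'a::complex_hilbert_space"
  assumes "r \<noteq> 0"
  shows "(norm (t - (cinner r t / of_real ((norm r)\<^sup>2)) *\<^sub>C r))\<^sup>2
    = (norm t)\<^sup>2 - (cmod (cinner r t))\<^sup>2 / (norm r)\<^sup>2"
proof -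
  define a where "a = cinner r t"
  define n where "n = (norm r)\<^sup>2"
  have n: "n \<noteq> 0" using assms by (simp add: n_def)
  have rt: "cinner t r = cnj a" by (simp add: a_def cinner_commute[symmetric])
  have "complex_of_real ((norm (t - (a / of_real n) *\<^sub>C r))\<^sup>2)
      = of_real ((norm t)\<^sup>2) - a * cnj a / of_real n"
    using n unfolding cinner_self[symmetric]
    by (simp add: cinner_simps rt a_def[symmetric] cinner_self[of r] n_def[symmetric] field_simps)
  also have "a * cnj a = of_real ((cmod a)\<^sup>2)" by (simp only: complex_norm_square)
  finally have "complex_of_real ((norm (t - (a / of_real n) *\<^sub>C r))\<^sup>2)
      = of_real ((norm t)\<^sup>2 - (cmod a)\<^sup>2 / n)" by simp
  then show ?thesis unfolding of_real_eq_iff a_def n_def .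
qed

lemma cinner_Cauchy_Schwarz: "cmod (cinner x y) \<le> norm x * norm (y::'a::complex_hilbert_space)"
proof (cases "x = 0")
  case False
  have "0 \<le> (norm y)\<^sup>2 - (cmod (cinner x y))\<^sup>2 / (norm x)\<^sup>2"
    using orthogonal_residual_norm[OF False, of y] by (metis zero_le_power2)
  then have "(cmod (cinner x y))\<^sup>2 \<le> (norm x * norm y)\<^sup>2"
    using False by (simp add: field_simps power_mult_distrib)
  then show ?thesis by (rule power2_le_imp_le) simp
qed simp

lemma bounded_linear_cinner_right: "bounded_linear (cinner (x::'a::complex_hilbert_space))"
  by (rule bounded_linear_intro[where K = "norm x"])
    (use cinner_Cauchy_Schwarz[of x] in \<open>simp_all add: cinner_simps scaleR_conv_of_real mult.commute[of _ "norm x"]\<close>)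

lemma power2_norm_convex_combination:
  fixes u v :: "'a::complex_hilbert_space"
  shows "(norm ((1 - t) *\<^sub>R u + t *\<^sub>R v))\<^sup>2
    = (1 - t) * (norm u)\<^sup>2 + t * (norm v)\<^sup>2 - t * (1 - t) * (norm (u - v))\<^sup>2"
  unfolding power2_norm_cinner
  by (simp add: cinner_simps Re_cinner_commute[of v u] algebra_simps)

text \<open>The residual \<open>t\<close> is the element of least norm in \<open>x - S\<close>,
  found as a common point of the sets of nearly minimal elements, with the squared norm as quadratic
  form. \<open>subspace\<close> is only real-linear, so stability under complex scalars is a
  separate assumption.\<close>

lemma orthogonal_decomposition:
  fixes S :: "'a::complex_hilbert_space set"
  assumes S: "closed S" "subspace S" and SC: "\<And>c s. s \<in> S \<Longrightarrow> c *\<^sub>C s \<in> S"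
  obtains s t where "x = s + t" "s \<in> S" "\<And>r. r \<in> S \<Longrightarrow> cinner r t = 0"
proof -
  define d where "d = infdist x S"
  define G where "G = (\<lambda>s. x - s) ` S"
  have G: "G = {a. x - a \<in> S}" by (force simp: G_def image_iff)
  have Sne: "S \<noteq> {}" using S(2) subspace_0 by blast
  define C where "C k = G \<inter> cball 0 (d + 1 / real (Suc k))" for k
  have closedG: "closed G"
    unfolding G by (rule continuous_closed_vimage[OF S(1), unfolded vimage_def])
      (intro continuous_intros)
  have "convex (C k)" for k
    unfolding C_def G
  proof (intro convex_Int convex_cball)
    have "{a. x - a \<in> S} = (\<lambda>s. x - s) ` S" using G G_def by simp
    moreover have "convex S" using S(2) by (rule subspace_imp_convex)
    moreover have "(\<lambda>s. x - s) ` S = (\<lambda>s. x + s) ` (uminus ` S)" by (auto simp: image_image)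
    ultimately show "convex {a. x - a \<in> S}"
      by (simp add: convex_translation convex_negations)
  qed
  moreover have "C k \<noteq> {}" for k
  proof -
    have "(INF a\<in>S. dist x a) < d + 1 / real (Suc k)"
      using Sne by (simp add: d_def infdist_def)
    then obtain a where "a \<in> S" "dist x a < d + 1 / real (Suc k)"
      using Sne by (subst (asm) cINF_less_iff) (auto intro: bdd_belowI[of _ 0])
    then have "x - a \<in> C k" by (auto simp: C_def G_def dist_norm norm_minus_commute)
    then show ?thesis by blast
  qed
  moreover have "decseq C"
  proof (rule decseq_SucI)
    fix k show "C (Suc k) \<subseteq> C k"
      unfolding C_def by (intro Int_mono subset_cball order_refl add_left_mono) (simp add: frac_le)
  qed
  moreover have "\<exists>B k. \<forall>a\<in>C k. \<exists>u\<in>UNIV. norm (a - id u) \<le> \<epsilon> \<and> (norm u)\<^sup>2 \<le> B" if "\<epsilon> > 0" for \<epsilon>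
  proof (intro exI ballI)
    fix a assume "a \<in> C 0"
    then have "norm a \<le> d + 1" by (simp add: C_def)
    then have "(norm a)\<^sup>2 \<le> (d + 1)\<^sup>2" by (intro power_mono) auto
    then show "\<exists>u\<in>UNIV. norm (a - id u) \<le> \<epsilon> \<and> (norm u)\<^sup>2 \<le> (d + 1)\<^sup>2"
      using that by (intro bexI[of _ a]) auto
  qed
  ultimately obtain z where z: "\<And>k. z \<in> closure (C k)"
    by (rule nested_convex_common_point[of UNIV id "\<lambda>u. (norm u)\<^sup>2" 1 C, rotated -5])
      (use power2_norm_convex_combination in \<open>auto simp: subspace_UNIV\<close>)
  have "closed (C k)" for k unfolding C_def using closedG by (intro closed_Int) auto
  then have zC: "z \<in> C k" for k using z[of k] by (simp add: closure_closed)
  then have zS: "x - z \<in> S" using G by (auto simp: C_def)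
  have zd: "norm z \<le> d"
  proof (rule field_le_epsilon)
    fix e :: real assume "e > 0"
    then obtain k where "1 / real (Suc k) < e" using nat_approx_posE by blast
    then show "norm z \<le> d + e" using zC[of k] by (simp add: C_def)
  qed
  have "cinner r z = 0" if r: "r \<in> S" for r
  proof (cases "r = 0")
    case False
    define b where "b = (cinner r z / of_real ((norm r)\<^sup>2)) *\<^sub>C r"
    have "x - z + b \<in> S" using zS SC[OF r] S(2) by (simp add: b_def subspace_add)
    then have "d \<le> dist x (x - z + b)" unfolding d_def by (rule infdist_le)
    then have "norm z \<le> norm (z - b)" using zd by (simp add: dist_norm)
    then have "(norm z)\<^sup>2 \<le> (norm (z - b))\<^sup>2" by (intro power_mono) auto
    then have "(cmod (cinner r z))\<^sup>2 / (norm r)\<^sup>2 \<le> 0"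
      using orthogonal_residual_norm[OF False, of z] unfolding b_def by linarith
    then show ?thesis using False by (simp add: divide_le_0_iff)
  qed simp
  then show ?thesis using that[of "x - z" z] zS by simp
qed

lemma riesz_representation:
  fixes f :: "'a::complex_hilbert_space \<Rightarrow> complex"
  assumes f: "bounded_linear f" and fC: "\<And>c x. f (c *\<^sub>C x) = c * f x"
  obtains \<zeta> where "\<And>x. f x = cinner \<zeta> x"
proof (cases "\<forall>x. f x = 0")
  case True
  then show ?thesis using that[of 0] by simp
next
  case False
  then obtain x0 where x0: "f x0 \<noteq> 0" by blast
  interpret f: bounded_linear f by (rule f)
  let ?S = "{x. f x = 0}"
  have "closed ?S" by (rule closed_Collect_eq) (auto intro: continuous_intros f.continuous_on)
  moreover have "subspace ?S" by (auto simp: subspace_def f.add f.scaleR f.zero)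
  ultimately obtain s t where st: "x0 = s + t" "s \<in> ?S" "\<And>r. r \<in> ?S \<Longrightarrow> cinner r t = 0"
    by (rule orthogonal_decomposition[where x = x0]) (auto simp: fC)
  have ft: "f t \<noteq> 0" using x0 st by (auto simp: f.add)
  then have tn: "complex_of_real ((norm t)\<^sup>2) \<noteq> 0" using f.zero by auto
  define \<zeta> where "\<zeta> = cnj (f t / of_real ((norm t)\<^sup>2)) *\<^sub>C t"
  have "f x = cinner \<zeta> x" for x
  proof -
    have "cinner (x - (f x / f t) *\<^sub>C t) t = 0"
      using ft by (intro st(3)) (simp add: f.diff fC)
    then have "cinner t (x - (f x / f t) *\<^sub>C t) = 0"
      by (subst cinner_commute) simp
    then have "cinner t x = (f x / f t) * of_real ((norm t)\<^sup>2)"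
      by (simp add: cinner_simps cinner_self)
    then show ?thesis using ft tn by (simp add: \<zeta>_def cinner_scaleC_left)
  qed
  then show ?thesis by (rule that)
qed

section \<open>Adjoints and positive operators\<close>

lemma scaleC_blinfun_apply [simp]:
  "blinfun_apply (c *\<^sub>C A) x = c *\<^sub>C blinfun_apply A (x::'a::real_normed_vector)"
  by (simp add: scaleC_blinfun.rep_eq)

lemma BH_apply_scaleC: "A \<in> BH \<Longrightarrow> blinfun_apply A (c *\<^sub>C x) = c *\<^sub>C blinfun_apply A x"
  by (simp add: BH_def bounded_clinear_def)

lemma BH_I: "(\<And>c x. blinfun_apply A (c *\<^sub>C x) = c *\<^sub>C blinfun_apply A x) \<Longrightarrow> A \<in> BH"
  by (simp add: BH_def bounded_clinear_def blinfun.bounded_linear_right)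

lemma scaleC_commute: "c *\<^sub>C d *\<^sub>C x = d *\<^sub>C c *\<^sub>C (x::'a::complex_normed_vector)"
  by (simp add: scaleC_scaleC mult.commute)

lemma blinfun_compose_assoc: "(A o\<^sub>L B) o\<^sub>L C = A o\<^sub>L (B o\<^sub>L C)"
  by (rule blinfun_eqI) simp

lemma blinfun_compose_id [simp]: "A o\<^sub>L id_blinfun = A" "id_blinfun o\<^sub>L A = A"
  by (simp_all add: blinfun_eqI)

lemma BH_id [simp]: "id_blinfun \<in> BH"
  by (rule BH_I) simp

lemma BH_zero [simp]: "0 \<in> BH"
  by (rule BH_I) simp

lemma BH_compose [simp]: "A \<in> BH \<Longrightarrow> B \<in> BH \<Longrightarrow> A o\<^sub>L B \<in> BH"
  by (rule BH_I) (simp add: BH_apply_scaleC)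

lemma BH_add [simp]: "A \<in> BH \<Longrightarrow> B \<in> BH \<Longrightarrow> A + B \<in> BH"
  by (rule BH_I) (simp add: BH_apply_scaleC blinfun.add_left scaleC_add_right)

lemma BH_diff [simp]: "A \<in> BH \<Longrightarrow> B \<in> BH \<Longrightarrow> A - B \<in> BH"
  by (rule BH_I) (simp add: BH_apply_scaleC blinfun.diff_left scaleC_diff_right)

lemma BH_scaleC [simp]: "A \<in> BH \<Longrightarrow> c *\<^sub>C A \<in> BH"
  by (rule BH_I) (simp add: BH_apply_scaleC scaleC_commute)

lemma BH_scaleR [simp]: "A \<in> BH \<Longrightarrow> r *\<^sub>R A \<in> BH"
  by (metis BH_scaleC scaleC_of_real)

lemma BH_LIMSEQ:
  fixes X :: "nat \<Rightarrow> 'h::complex_hilbert_space \<Rightarrow>\<^sub>L 'h"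
  assumes "\<And>n. X n \<in> BH" and X: "X \<longlonglongrightarrow> A"
  shows "A \<in> BH"
proof (rule BH_I)
  fix c x
  have lim: "(\<lambda>n. X n y) \<longlonglongrightarrow> A y" for y
    by (intro bounded_linear.tendsto[OF blinfun.bounded_linear_left X])
  have "(\<lambda>n. c *\<^sub>C X n x) \<longlonglongrightarrow> c *\<^sub>C A x"
    by (intro bounded_linear.tendsto[OF bounded_linear_scaleC_right lim])
  moreover have "(\<lambda>n. c *\<^sub>C X n x) \<longlonglongrightarrow> A (c *\<^sub>C x)"
    using lim[of "c *\<^sub>C x"] assms(1) by (simp add: BH_apply_scaleC)
  ultimately show "A (c *\<^sub>C x) = c *\<^sub>C A x" by (metis LIMSEQ_unique)
qed

lemma adj_equality:
  assumes "\<And>\<xi> \<eta>. cinner (blinfun_apply A \<xi>) \<eta> = cinner \<xi> (blinfun_apply B \<eta>)"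
  shows "adj A = B"
  unfolding adj_def
proof (rule the_equality)
  fix B' assume B': "\<forall>\<xi> \<eta>. cinner (blinfun_apply A \<xi>) \<eta> = cinner \<xi> (blinfun_apply B' \<eta>)"
  show "B' = B"
    by (rule blinfun_eqI, rule cinner_ext) (use assms B' in metis)
qed (use assms in blast)

text \<open>Riesz representation of \<open>cinner \<eta> (A \<xi>)\<close> as a functional of
  \<open>\<xi>\<close> produces the adjoint; this gives the definite description in
  \<open>adj\<close> a meaning on \<open>BH\<close>.\<close>

lemma cinner_adj_right:
  assumes A: "A \<in> BH"
  shows "cinner (blinfun_apply A \<xi>) \<eta> = cinner \<xi> (blinfun_apply (adj A) \<eta>)"
proof -
  have "\<exists>\<zeta>. \<forall>\<xi>. cinner \<eta> (A \<xi>) = cinner \<zeta> \<xi>" for \<eta>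
  proof -
    have "bounded_linear (\<lambda>\<xi>. cinner \<eta> (A \<xi>))"
      by (intro bounded_linear_compose[OF bounded_linear_cinner_right] blinfun.bounded_linear_right)
    then obtain \<zeta> where "\<And>\<xi>. cinner \<eta> (A \<xi>) = cinner \<zeta> \<xi>"
      by (rule riesz_representation) (use A in \<open>simp_all add: BH_apply_scaleC cinner_scaleC_right\<close>)
    then show ?thesis by blast
  qed
  then obtain b where b: "\<And>\<eta> \<xi>. cinner \<eta> (A \<xi>) = cinner (b \<eta>) \<xi>" by metis
  have b': "cinner (A \<xi>) \<eta> = cinner \<xi> (b \<eta>)" for \<xi> \<eta>
    using b[of \<eta> \<xi>] cinner_commute[of "A \<xi>" \<eta>] cinner_commute[of \<xi> "b \<eta>"] by simp
  have "bounded_linear b"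
  proof (rule bounded_linear_intro[where K = "norm A"])
    show "b (x + y) = b x + b y" for x y
      by (rule cinner_ext) (simp add: cinner_add_right b'[symmetric])
    show "b (r *\<^sub>R x) = r *\<^sub>R b x" for r x
      by (rule cinner_ext) (simp add: cinner_scaleR_right b'[symmetric])
    show "norm (b x) \<le> norm x * norm A" for x
    proof (cases "b x = 0")
      case False
      have "(norm (b x))\<^sup>2 = cmod (cinner x (A (b x)))"
        using b[of x "b x"] by (simp add: cinner_self norm_power)
      also have "\<dots> \<le> norm x * (norm A * norm (b x))"
        by (intro order_trans[OF cinner_Cauchy_Schwarz] mult_left_mono norm_blinfun) simp
      finally show ?thesis using False by (simp add: power2_eq_square mult.assoc[symmetric])
    qed simp
  qed
  then have "blinfun_apply (Blinfun b) = b" by (rule bounded_linear_Blinfun_apply)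
  then have "adj A = Blinfun b" by (intro adj_equality) (simp add: b')
  then show ?thesis using b' \<open>blinfun_apply (Blinfun b) = b\<close> by simp
qed

lemma cinner_adj_left: "A \<in> BH \<Longrightarrow> cinner (blinfun_apply (adj A) \<xi>) \<eta> = cinner \<xi> (blinfun_apply A \<eta>)"
  using cinner_commute[of "adj A \<xi>" \<eta>] cinner_commute[of \<xi> "A \<eta>"] cinner_adj_right[of A \<eta> \<xi>]
  by simp

lemma adj_BH [simp]: "A \<in> BH \<Longrightarrow> adj A \<in> BH"
  by (intro BH_I cinner_ext)
    (simp add: cinner_adj_right[symmetric] cinner_scaleC_right)

lemma adj_adj [simp]: "A \<in> BH \<Longrightarrow> adj (adj A) = A"
  by (rule adj_equality) (rule cinner_adj_left)

lemma adj_id [simp]: "adj id_blinfun = id_blinfun"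
  by (rule adj_equality) simp

lemma adj_compose: "A \<in> BH \<Longrightarrow> B \<in> BH \<Longrightarrow> adj (A o\<^sub>L B) = adj B o\<^sub>L adj A"
  by (rule adj_equality) (simp add: cinner_adj_right)

lemma adj_add: "A \<in> BH \<Longrightarrow> B \<in> BH \<Longrightarrow> adj (A + B) = adj A + adj B"
  by (rule adj_equality) (simp add: cinner_adj_right cinner_simps blinfun.add_left)

lemma adj_diff: "A \<in> BH \<Longrightarrow> B \<in> BH \<Longrightarrow> adj (A - B) = adj A - adj B"
  by (rule adj_equality) (simp add: cinner_adj_right cinner_simps blinfun.diff_left)

lemma adj_scaleC: "A \<in> BH \<Longrightarrow> adj (c *\<^sub>C A) = cnj c *\<^sub>C adj A"
  by (rule adj_equality) (simp add: cinner_adj_right cinner_simps)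

lemma adj_scaleR: "A \<in> BH \<Longrightarrow> adj (r *\<^sub>R A) = r *\<^sub>R adj A"
  by (metis adj_scaleC scaleC_of_real complex_cnj_complex_of_real)

definition hermitian :: "('h::complex_hilbert_space \<Rightarrow>\<^sub>L 'h) \<Rightarrow> bool"
  where "hermitian A \<longleftrightarrow> A \<in> BH \<and> adj A = A"

lemma hermitian_BH: "hermitian A \<Longrightarrow> A \<in> BH"
  by (simp add: hermitian_def)

lemma hermitian_cinner: "hermitian A \<Longrightarrow> cinner (blinfun_apply A \<xi>) \<eta> = cinner \<xi> (blinfun_apply A \<eta>)"
  using cinner_adj_right[of A] by (simp add: hermitian_def)

lemma hermitianI:
  "A \<in> BH \<Longrightarrow> (\<And>\<xi> \<eta>. cinner (blinfun_apply A \<xi>) \<eta> = cinner \<xi> (blinfun_apply A \<eta>)) \<Longrightarrow> hermitian A"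
  by (simp add: hermitian_def adj_equality)

lemma hermitian_id [simp]: "hermitian id_blinfun"
  by (simp add: hermitian_def)

lemma hermitian_add: "hermitian A \<Longrightarrow> hermitian B \<Longrightarrow> hermitian (A + B)"
  by (simp add: hermitian_def adj_add)

lemma hermitian_diff: "hermitian A \<Longrightarrow> hermitian B \<Longrightarrow> hermitian (A - B)"
  by (simp add: hermitian_def adj_diff)

lemma hermitian_scaleR: "hermitian A \<Longrightarrow> hermitian (r *\<^sub>R A)"
  by (simp add: hermitian_def adj_scaleR)

lemma hermitian_sandwich: "hermitian A \<Longrightarrow> B \<in> BH \<Longrightarrow> hermitian (adj B o\<^sub>L A o\<^sub>L B)"
  by (simp add: hermitian_def adj_compose blinfun_compose_assoc)

lemma hermitian_square: "hermitian A \<Longrightarrow> hermitian (A o\<^sub>L A)"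
  by (simp add: hermitian_def adj_compose)

lemma hermitian_cinner_Im: "hermitian A \<Longrightarrow> Im (cinner \<xi> (blinfun_apply A \<xi>)) = 0"
  using arg_cong[OF cinner_commute[of \<xi> "A \<xi>"], of Im]
    arg_cong[OF hermitian_cinner[of A \<xi> \<xi>], of Im] by (simp only: cnj.sel)

lemma hermitian_LIMSEQ:
  fixes X :: "nat \<Rightarrow> 'h::complex_hilbert_space \<Rightarrow>\<^sub>L 'h"
  assumes "\<And>n. hermitian (X n)" and X: "X \<longlonglongrightarrow> A"
  shows "hermitian A"
proof (rule hermitianI)
  show "A \<in> BH" by (rule BH_LIMSEQ[OF _ X]) (rule hermitian_BH[OF assms(1)])
  fix \<xi> \<eta>
  have lim0: "(\<lambda>n. X n x) \<longlonglongrightarrow> A x" for x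
    by (intro bounded_linear.tendsto[OF blinfun.bounded_linear_left X])
  have lim: "(\<lambda>n. cinner \<zeta> (X n x)) \<longlonglongrightarrow> cinner \<zeta> (A x)" for \<zeta> x
    using bounded_linear.tendsto[OF bounded_linear_cinner_right lim0, of \<zeta>] .
  have "cnj (cinner \<eta> (X n \<xi>)) = cinner \<xi> (X n \<eta>)" for n
    using hermitian_cinner[OF assms(1), of n \<xi> \<eta>] cinner_commute[of "X n \<xi>" \<eta>] by simp
  moreover have "(\<lambda>n. cnj (cinner \<eta> (X n \<xi>))) \<longlonglongrightarrow> cnj (cinner \<eta> (A \<xi>))"
    by (rule tendsto_cnj[OF lim])
  ultimately have "(\<lambda>n. cinner \<xi> (X n \<eta>)) \<longlonglongrightarrow> cinner (A \<xi>) \<eta>"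
    using cinner_commute[of "A \<xi>" \<eta>] by simp
  then show "cinner (A \<xi>) \<eta> = cinner \<xi> (A \<eta>)"
    by (rule LIMSEQ_unique[OF _ lim])
qed

lemma op_pos_BH: "op_pos A \<Longrightarrow> A \<in> BH"
  by (simp add: op_pos_def)

lemma op_pos_Re: "op_pos A \<Longrightarrow> 0 \<le> Re (cinner \<xi> (blinfun_apply A \<xi>))"
  by (simp add: op_pos_def complex_nonneg_Reals_iff)

text \<open>Complex polarization: real values of the form at \<open>\<xi> + \<eta>\<close> control
  the imaginary parts of the off-diagonal entries, those at
  \<open>\<xi> + \<i> *\<^sub>C \<eta>\<close> their real parts.\<close>

lemma op_pos_hermitian:
  assumes A: "op_pos A"
  shows "hermitian A"
proof (rule hermitianI)
  show BH: "A \<in> BH" using A by (rule op_pos_BH)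
  fix \<xi> \<eta>
  have im: "Im (cinner x (A x)) = 0" for x
    using A by (simp add: op_pos_def complex_nonneg_Reals_iff)
  have "Im (cinner \<xi> (A \<eta>) + cinner \<eta> (A \<xi>)) = 0"
    using im[of "\<xi> + \<eta>"] im[of \<xi>] im[of \<eta>] by (simp add: blinfun.add_right cinner_simps)
  moreover have "Re (cinner \<xi> (A \<eta>) - cinner \<eta> (A \<xi>)) = 0"
    using im[of "\<xi> + \<i> *\<^sub>C \<eta>"] im[of \<xi>] im[of \<eta>]
    by (simp add: blinfun.add_right cinner_simps BH_apply_scaleC[OF BH])
  ultimately have "cnj (cinner \<eta> (A \<xi>)) = cinner \<xi> (A \<eta>)" by (simp add: complex_eq_iff)
  then show "cinner (A \<xi>) \<eta> = cinner \<xi> (A \<eta>)"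
    using cinner_commute[of "A \<xi>" \<eta>] by simp
qed

lemma op_posI: "hermitian A \<Longrightarrow> (\<And>\<xi>. 0 \<le> Re (cinner \<xi> (blinfun_apply A \<xi>))) \<Longrightarrow> op_pos A"
  by (simp add: op_pos_def hermitian_BH complex_nonneg_Reals_iff hermitian_cinner_Im)

lemma op_pos_add: "op_pos A \<Longrightarrow> op_pos B \<Longrightarrow> op_pos (A + B)"
  by (rule op_posI) (simp_all add: hermitian_add op_pos_hermitian blinfun.add_left cinner_simps op_pos_Re)

lemma op_pos_scaleR: "op_pos A \<Longrightarrow> 0 \<le> r \<Longrightarrow> op_pos (r *\<^sub>R A)"
  by (rule op_posI) (simp_all add: hermitian_scaleR op_pos_hermitian blinfun.scaleR_left cinner_simps op_pos_Re)

lemma op_pos_sandwich: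
  assumes "op_pos A" "B \<in> BH"
  shows "op_pos (adj B o\<^sub>L A o\<^sub>L B)"
proof (rule op_posI)
  show "hermitian (adj B o\<^sub>L A o\<^sub>L B)" using assms by (simp add: hermitian_sandwich op_pos_hermitian)
qed (use assms in \<open>simp add: cinner_adj_right[symmetric] op_pos_Re\<close>)

lemma op_pos_id [simp]: "op_pos id_blinfun"
  by (rule op_posI) (simp_all add: cinner_self)

lemma op_pos_adj_compose: "A \<in> BH \<Longrightarrow> op_pos (adj A o\<^sub>L A)"
  using op_pos_sandwich[OF op_pos_id, of A] by simp

lemma hermitian_norm_bound:
  assumes "hermitian A" "norm A \<le> r"
  shows "op_pos (r *\<^sub>R id_blinfun - A)"
proof (rule op_posI)
  show "hermitian (r *\<^sub>R id_blinfun - A)"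
    using assms by (simp add: hermitian_diff hermitian_scaleR)
  fix \<xi>
  have "Re (cinner \<xi> (A \<xi>)) \<le> norm \<xi> * norm (A \<xi>)"
    using cinner_Cauchy_Schwarz complex_Re_le_cmod order_trans by blast
  also have "\<dots> \<le> norm \<xi> * (r * norm \<xi>)"
    using order_trans[OF norm_blinfun[of A \<xi>] mult_right_mono[OF assms(2)]]
    by (intro mult_left_mono) auto
  finally show "0 \<le> Re (cinner \<xi> (blinfun_apply (r *\<^sub>R id_blinfun - A) \<xi>))"
    by (simp add: blinfun.diff_left blinfun.scaleR_left cinner_simps cinner_self power2_eq_square mult_ac)
qed

text \<open>Expanding \<open>\<langle>\<xi> - K\<^sup>-\<^sup>1 A \<xi>, A (\<xi> - K\<^sup>-\<^sup>1 A \<xi>)\<rangle> \<ge> 0\<close> replaces the Cauchy-Schwarz inequality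
  for the form of \<open>A\<close>.\<close>

lemma op_pos_norm_apply_le:
  assumes A: "op_pos A" and K: "K > 0" and AK: "\<And>\<xi>. Re (cinner \<xi> (blinfun_apply A \<xi>)) \<le> K * (norm \<xi>)\<^sup>2"
  shows "(norm (blinfun_apply A \<xi>))\<^sup>2 \<le> K * Re (cinner \<xi> (blinfun_apply A \<xi>))"
proof -
  define \<eta> where "\<eta> = A \<xi>"
  have h: "cinner (A x) y = cinner x (A y)" for x y
    using A by (intro hermitian_cinner op_pos_hermitian)
  have 1: "Re (cinner \<xi> (A \<eta>)) = (norm \<eta>)\<^sup>2"
    unfolding h[symmetric] by (simp add: \<eta>_def power2_norm_cinner)
  have 2: "Re (cinner \<eta> (A \<xi>)) = (norm \<eta>)\<^sup>2"
    by (simp add: \<eta>_def power2_norm_cinner)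
  have "0 \<le> Re (cinner (\<xi> - (1 / K) *\<^sub>R \<eta>) (A (\<xi> - (1 / K) *\<^sub>R \<eta>)))"
    using A by (rule op_pos_Re)
  also have "\<dots> = Re (cinner \<xi> (A \<xi>)) - 2 * (norm \<eta>)\<^sup>2 / K + Re (cinner \<eta> (A \<eta>)) / K\<^sup>2"
    using K by (simp add: blinfun.diff_right blinfun.scaleR_right cinner_simps 1 2)
      (simp add: field_simps power2_eq_square)
  also have "\<dots> \<le> Re (cinner \<xi> (A \<xi>)) - 2 * (norm \<eta>)\<^sup>2 / K + K * (norm \<eta>)\<^sup>2 / K\<^sup>2"
    using AK[of \<eta>] by (intro add_left_mono divide_right_mono) auto
  also have "\<dots> = Re (cinner \<xi> (A \<xi>)) - (norm \<eta>)\<^sup>2 / K"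
    using K by (simp add: power2_eq_square)
  finally show ?thesis using K by (simp add: \<eta>_def field_simps)
qed

lemma op_pos_norm_apply:
  assumes A: "op_pos A"
  shows "(norm (blinfun_apply A \<xi>))\<^sup>2 \<le> (norm A + 1) * Re (cinner \<xi> (blinfun_apply A \<xi>))"
proof (rule op_pos_norm_apply_le[OF A])
  fix \<xi>
  show "Re (cinner \<xi> (A \<xi>)) \<le> (norm A + 1) * (norm \<xi>)\<^sup>2"
    using op_pos_Re[OF hermitian_norm_bound[OF op_pos_hermitian[OF A], of "norm A + 1"], of \<xi>]
    by (simp add: blinfun.diff_left blinfun.scaleR_left cinner_simps cinner_self)
qed (simp add: add_nonneg_pos)

lemma op_pos_apply_eq_0:
  assumes A: "op_pos A" and z: "Re (cinner \<xi> (blinfun_apply A \<xi>)) = 0"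
  shows "blinfun_apply A \<xi> = 0"
  using op_pos_norm_apply[OF A, of \<xi>] z by simp

lemma op_pos_norm_le:
  assumes A: "op_pos A" and K: "K \<ge> 0" and AK: "op_pos (K *\<^sub>R id_blinfun - A)"
  shows "norm A \<le> K"
\<comment> \<open>\<open>op_pos_norm_apply_le\<close> requires a strictly positive constant, while
  \<open>K\<close> may be 0; hence the detour through \<open>K + e\<close>.\<close>
proof (rule field_le_epsilon)
  fix e :: real assume e: "e > 0"
  have AK': "Re (cinner \<xi> (A \<xi>)) \<le> K * (norm \<xi>)\<^sup>2" for \<xi>
    using op_pos_Re[OF AK, of \<xi>]
    by (simp add: blinfun.diff_left blinfun.scaleR_left cinner_simps cinner_self)
  show "norm A \<le> K + e"
  proof (rule norm_blinfun_bound)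
    fix \<xi>
    have le: "Re (cinner x (A x)) \<le> (K + e) * (norm x)\<^sup>2" for x
      using AK'[of x] mult_right_mono[of K "K + e" "(norm x)\<^sup>2"] e by simp
    then have "(norm (A \<xi>))\<^sup>2 \<le> (K + e) * Re (cinner \<xi> (A \<xi>))"
      using K e by (intro op_pos_norm_apply_le[OF A]) auto
    also have "\<dots> \<le> (K + e) * ((K + e) * (norm \<xi>)\<^sup>2)"
      using K e le by (intro mult_left_mono) auto
    also have "\<dots> = ((K + e) * norm \<xi>)\<^sup>2" by (simp add: power2_eq_square mult_ac)
    finally show "norm (A \<xi>) \<le> (K + e) * norm \<xi>"
      by (rule power2_le_imp_le) (use K e in simp)
  qed (use K e in simp)
qed

section \<open>Square roots and spectral cut-offs\<close>

lemmas blinfun_apply_simps = blinfun.add_left blinfun.diff_left blinfun.scaleR_left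
  blinfun.minus_left blinfun.add_right blinfun.diff_right blinfun.scaleR_right blinfun.minus_right

text \<open>Fixed-point iteration for \<open>Y = (T + Y\<^sup>2) / 2\<close>, whose solution gives \<open>(1 - Y)\<^sup>2 = 1 - T\<close>.
  The scalar iteration for \<open>T = 1\<close> majorizes it, so it converges in norm for \<open>\<parallel>T\<parallel> \<le> 1\<close>.\<close>

primrec sqrt_iter :: "('a::real_normed_vector \<Rightarrow>\<^sub>L 'a) \<Rightarrow> nat \<Rightarrow> 'a \<Rightarrow>\<^sub>L 'a"
  where "sqrt_iter T 0 = 0"
  | "sqrt_iter T (Suc n) = (1 / 2) *\<^sub>R (T + (sqrt_iter T n o\<^sub>L sqrt_iter T n))"

primrec sqrt_majorant :: "nat \<Rightarrow> real"
  where "sqrt_majorant 0 = 0"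
  | "sqrt_majorant (Suc n) = (1 + (sqrt_majorant n)\<^sup>2) / 2"

lemma sqrt_majorant_bounds: "0 \<le> sqrt_majorant n \<and> sqrt_majorant n \<le> 1"
proof (induction n)
  case (Suc n)
  then have "(sqrt_majorant n)\<^sup>2 \<le> 1" by (simp add: power_le_one)
  then show ?case by (simp add: add_nonneg_nonneg)
qed simp

text \<open>The increment equals \<open>(1 - u)\<^sup>2 / 2\<close> for
  \<open>u = sqrt_majorant n\<close>.\<close>

lemma sqrt_majorant_mono: "sqrt_majorant n \<le> sqrt_majorant (Suc n)"
  using zero_le_power2[of "1 - sqrt_majorant n"] by (simp add: power2_diff)

lemma sqrt_iter_norm:
  assumes T: "norm T \<le> 1"
  shows "norm (sqrt_iter T n) \<le> sqrt_majorant n"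
proof (induction n)
  case (Suc n)
  have "norm (sqrt_iter T n o\<^sub>L sqrt_iter T n) \<le> sqrt_majorant n * sqrt_majorant n"
    by (rule order_trans[OF norm_blinfun_compose mult_mono[OF Suc Suc]])
      (use sqrt_majorant_bounds[of n] in simp_all)
  then have "norm (T + (sqrt_iter T n o\<^sub>L sqrt_iter T n)) \<le> 1 + sqrt_majorant n * sqrt_majorant n"
    using norm_triangle_ineq[of T "sqrt_iter T n o\<^sub>L sqrt_iter T n"] T by linarith
  then show ?case by (simp add: power2_eq_square)
qed simp

text \<open>For \<open>norm T = 1\<close> the Lipschitz factor of the iteration is bounded only by
  1, so a contraction argument fails; increments are instead dominated by scalar ones, whose sum
  telescopes.\<close>

lemma sqrt_iter_step:
  assumes T: "norm T \<le> 1"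
  shows "norm (sqrt_iter T (Suc n) - sqrt_iter T n) \<le> sqrt_majorant (Suc n) - sqrt_majorant n"
proof (induction n)
  case 0
  then show ?case using T by simp
next
  case (Suc n)
  define Y where "Y = sqrt_iter T n"
  define Y' where "Y' = sqrt_iter T (Suc n)"
  define u where "u = sqrt_majorant n"
  define u' where "u' = sqrt_majorant (Suc n)"
  have D: "norm (Y' - Y) \<le> u' - u" using Suc by (simp only: Y_def Y'_def u_def u'_def)
  have n: "norm Y \<le> u" "norm Y' \<le> u'" using sqrt_iter_norm[OF T] unfolding Y_def Y'_def u_def u'_def by blast+
  have u: "0 \<le> u" "0 \<le> u'" using sqrt_majorant_bounds unfolding u_def u'_def by blast+
  have u2: "u \<le> u'" unfolding u_def u'_def by (rule sqrt_majorant_mono)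
  have "sqrt_iter T (Suc (Suc n)) - sqrt_iter T (Suc n)
      = (1 / 2) *\<^sub>R (T + (Y' o\<^sub>L Y')) - (1 / 2) *\<^sub>R (T + (Y o\<^sub>L Y))"
    unfolding Y'_def Y_def by simp
  \<comment> \<open>This splitting of the difference of squares needs no commutation, and the scalar
    difference of squares splits in the same way.\<close>
  also have "\<dots> = (1 / 2) *\<^sub>R ((Y' o\<^sub>L (Y' - Y)) + ((Y' - Y) o\<^sub>L Y))"
    by (rule blinfun_eqI) (simp add: blinfun_apply_simps algebra_simps)
  finally have "norm (sqrt_iter T (Suc (Suc n)) - sqrt_iter T (Suc n))
      = norm ((Y' o\<^sub>L (Y' - Y)) + ((Y' - Y) o\<^sub>L Y)) / 2" by simp
  also have "\<dots> \<le> (norm (Y' o\<^sub>L (Y' - Y)) + norm ((Y' - Y) o\<^sub>L Y)) / 2"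
    by (simp add: norm_triangle_ineq)
  also have "\<dots> \<le> (u' * (u' - u) + (u' - u) * u) / 2"
    by (intro divide_right_mono add_mono order_trans[OF norm_blinfun_compose mult_mono])
      (use D n u u2 in simp_all)
  also have "\<dots> = sqrt_majorant (Suc (Suc n)) - sqrt_majorant (Suc n)"
    by (simp add: u'_def u_def power2_eq_square field_simps)
  finally show ?case .
qed

lemma sqrt_iter_limit:
  fixes T :: "'a::banach \<Rightarrow>\<^sub>L 'a"
  assumes T: "norm T \<le> 1"
  obtains Y where "sqrt_iter T \<longlonglongrightarrow> Y" "norm Y \<le> 1" "Y = (1 / 2) *\<^sub>R (T + (Y o\<^sub>L Y))"
proof -
  have le: "norm (sqrt_iter T m - sqrt_iter T n) \<le> sqrt_majorant m - sqrt_majorant n" if "n \<le> m" for m n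
    using that
  proof (induction m rule: dec_induct)
    case (step m)
    have "norm (sqrt_iter T (Suc m) - sqrt_iter T n)
        \<le> norm (sqrt_iter T (Suc m) - sqrt_iter T m) + norm (sqrt_iter T m - sqrt_iter T n)"
      by (rule order_trans[OF _ norm_triangle_ineq]) (simp del: sqrt_iter.simps)
    then show ?case using step sqrt_iter_step[OF T, of m] by linarith
  qed simp
  have "convergent sqrt_majorant"
  proof (rule Bseq_monoseq_convergent)
    show "Bseq sqrt_majorant"
      by (rule BseqI'[of _ 1]) (use sqrt_majorant_bounds in \<open>simp add: abs_le_iff order_trans[OF _ sqrt_majorant_bounds[THEN conjunct1]]\<close>)
    show "monoseq sqrt_majorant" by (rule mono_SucI1) (intro allI sqrt_majorant_mono)
  qed
  then have C: "Cauchy sqrt_majorant" by (rule convergent_Cauchy)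
  have "Cauchy (sqrt_iter T)"
  proof (rule CauchyI')
    fix e :: real assume "e > 0"
    then obtain N where N: "\<And>m n. m \<ge> N \<Longrightarrow> n \<ge> N \<Longrightarrow> norm (sqrt_majorant m - sqrt_majorant n) < e"
      using CauchyD[OF C] by blast
    have "norm (sqrt_iter T m - sqrt_iter T n) < e" if "m \<ge> N" "n > m" for m n
    proof -
      have "norm (sqrt_iter T m - sqrt_iter T n) = norm (sqrt_iter T n - sqrt_iter T m)"
        by (rule norm_minus_commute)
      also have "\<dots> \<le> sqrt_majorant n - sqrt_majorant m" using that by (intro le) simp
      also have "\<dots> < e" using N[of n m] that by simp
      finally show ?thesis .
    qed
    then show "\<exists>M. \<forall>m\<ge>M. \<forall>n>m. dist (sqrt_iter T m) (sqrt_iter T n) < e"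
      unfolding dist_norm by blast
  qed
  then obtain Y where Y: "sqrt_iter T \<longlonglongrightarrow> Y" using Cauchy_convergent convergent_def by blast
  have "norm Y \<le> 1"
  proof (rule LIMSEQ_le_const2[OF tendsto_norm[OF Y]])
    show "\<exists>N. \<forall>n\<ge>N. norm (sqrt_iter T n) \<le> 1"
      using sqrt_iter_norm[OF T] sqrt_majorant_bounds order_trans by blast
  qed
  moreover have "(\<lambda>n. sqrt_iter T (Suc n)) \<longlonglongrightarrow> (1 / 2) *\<^sub>R (T + (Y o\<^sub>L Y))"
    unfolding sqrt_iter.simps
    by (intro tendsto_scaleR tendsto_add tendsto_const
        bounded_bilinear.tendsto[OF bounded_bilinear_blinfun_compose] Y)
  then have "Y = (1 / 2) *\<^sub>R (T + (Y o\<^sub>L Y))"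
    using LIMSEQ_Suc[OF Y] LIMSEQ_unique by blast
  ultimately show ?thesis using that Y by blast
qed

lemma sqrt_iter_hermitian:
  assumes "hermitian T"
  shows "hermitian (sqrt_iter T n)"
proof (induction n)
  case 0
  show ?case by (rule hermitianI) simp_all
next
  case (Suc n)
  then show ?case by (simp add: hermitian_scaleR hermitian_add hermitian_square assms)
qed

lemma sqrt_iter_commute:
  assumes "B o\<^sub>L T = T o\<^sub>L B"
  shows "B o\<^sub>L sqrt_iter T n = sqrt_iter T n o\<^sub>L B"
proof (induction n)
  case (Suc n)
  have c: "B (T x) = T (B x)" for x using assms by (metis blinfun_apply_blinfun_compose)
  have "B (sqrt_iter T n x) = sqrt_iter T n (B x)" for x
    using Suc by (metis blinfun_apply_blinfun_compose)
  then show ?case by (intro blinfun_eqI) (simp add: blinfun_apply_simps c)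
qed (simp add: blinfun_eqI)

text \<open>The convergence clause keeps the approximants accessible:
  \<open>norm_\<iota>_adj_contraction\<close> compares traces along them. The commutation clause
  passes from the iterates to their norm limit.\<close>

lemma sqrt_one_minus:
  assumes T: "hermitian T" "norm T \<le> 1"
  obtains S where "op_pos S" "S o\<^sub>L S = id_blinfun - T"
    "(\<lambda>n. id_blinfun - sqrt_iter T n) \<longlonglongrightarrow> S"
    "\<And>B. B o\<^sub>L T = T o\<^sub>L B \<Longrightarrow> B o\<^sub>L S = S o\<^sub>L B"
proof -
  obtain Y where Y: "sqrt_iter T \<longlonglongrightarrow> Y" "norm Y \<le> 1" and YT: "Y = (1 / 2) *\<^sub>R (T + (Y o\<^sub>L Y))"
    by (rule sqrt_iter_limit[OF T(2)])
  define S where "S = id_blinfun - Y"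
  have "hermitian Y" by (rule hermitian_LIMSEQ[OF sqrt_iter_hermitian[OF T(1)] Y(1)])
  then have "op_pos S" using hermitian_norm_bound[of Y 1] Y(2) by (simp add: S_def)
  moreover have "S o\<^sub>L S = id_blinfun - T"
  proof (rule blinfun_eqI)
    fix x
    have "Y x = (1 / 2) *\<^sub>R (T x + Y (Y x))"
      using arg_cong[OF YT, of "\<lambda>A. blinfun_apply A x"] by (simp add: blinfun_apply_simps)
    then have "2 *\<^sub>R Y x = 2 *\<^sub>R ((1 / 2) *\<^sub>R (T x + Y (Y x)))" by (rule arg_cong)
    then have "2 *\<^sub>R Y x = T x + Y (Y x)" by simp
    then show "(S o\<^sub>L S) x = (id_blinfun - T) x"
      by (simp add: S_def blinfun_apply_simps scaleR_2 algebra_simps)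
  qed
  moreover have "(\<lambda>n. id_blinfun - sqrt_iter T n) \<longlonglongrightarrow> S"
    unfolding S_def by (intro tendsto_diff tendsto_const Y)
  moreover have "B o\<^sub>L S = S o\<^sub>L B" if B: "B o\<^sub>L T = T o\<^sub>L B" for B
  proof -
    have 1: "(\<lambda>n. B o\<^sub>L sqrt_iter T n) \<longlonglongrightarrow> (B o\<^sub>L Y)"
      by (intro bounded_bilinear.tendsto[OF bounded_bilinear_blinfun_compose] tendsto_const Y)
    have 2: "(\<lambda>n. sqrt_iter T n o\<^sub>L B) \<longlonglongrightarrow> (Y o\<^sub>L B)"
      by (intro bounded_bilinear.tendsto[OF bounded_bilinear_blinfun_compose] tendsto_const Y)
    have "B o\<^sub>L Y = Y o\<^sub>L B"
      using 1 2 unfolding sqrt_iter_commute[OF B] by (rule LIMSEQ_unique)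
    then have "B (Y x) = Y (B x)" for x by (metis blinfun_apply_blinfun_compose)
    then show ?thesis by (intro blinfun_eqI) (simp add: S_def blinfun_apply_simps)
  qed
  ultimately show ?thesis by (rule that)
qed

lemma op_pos_sqrt_exists:
  assumes X: "op_pos X"
  obtains S where "op_pos S" "S o\<^sub>L S = X" "\<And>B. B o\<^sub>L X = X o\<^sub>L B \<Longrightarrow> B o\<^sub>L S = S o\<^sub>L B"
proof -
  \<comment> \<open>The summand 1 keeps \<open>r\<close> positive even for \<open>X = 0\<close>.
    Then \<open>T\<close> lies between 0 and 1, and \<open>1 - T\<close> is
    \<open>X / r\<close>.\<close>
  define r where "r = norm X + 1"
  have r: "r > 0" by (simp add: r_def add_nonneg_pos)
  define T where "T = id_blinfun - (1 / r) *\<^sub>R X"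
  have hX: "hermitian ((1 / r) *\<^sub>R X)" using X by (intro hermitian_scaleR op_pos_hermitian)
  have "op_pos (1 *\<^sub>R id_blinfun - (1 / r) *\<^sub>R X)"
    by (rule hermitian_norm_bound[OF hX]) (use r in \<open>simp add: r_def field_simps\<close>)
  then have T: "op_pos T" by (simp add: T_def)
  have "norm T \<le> 1"
    by (rule op_pos_norm_le[OF T]) (use op_pos_scaleR[OF X, of "1 / r"] r in \<open>simp_all add: T_def\<close>)
  with op_pos_hermitian[OF T] obtain S where S: "op_pos S" "S o\<^sub>L S = id_blinfun - T"
    and comm: "\<And>B. B o\<^sub>L T = T o\<^sub>L B \<Longrightarrow> B o\<^sub>L S = S o\<^sub>L B"
    using sqrt_one_minus by blast
  show ?thesis
  proof
    show "op_pos (sqrt r *\<^sub>R S)" using S r by (intro op_pos_scaleR) simp_all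
    have SS: "S (S x) = (1 / r) *\<^sub>R X x" for x
      using arg_cong[OF S(2), of "\<lambda>A. blinfun_apply A x"] by (simp add: T_def blinfun_apply_simps)
    show "(sqrt r *\<^sub>R S) o\<^sub>L (sqrt r *\<^sub>R S) = X"
      by (rule blinfun_eqI) (use r in \<open>simp add: blinfun_apply_simps SS\<close>)
    fix B assume "B o\<^sub>L X = X o\<^sub>L B"
    then have "B (X x) = X (B x)" for x by (metis blinfun_apply_blinfun_compose)
    then have "B o\<^sub>L T = T o\<^sub>L B"
      by (intro blinfun_eqI) (simp add: T_def blinfun_apply_simps)
    then have "B (S x) = S (B x)" for x using comm by (metis blinfun_apply_blinfun_compose)
    then show "B o\<^sub>L (sqrt r *\<^sub>R S) = (sqrt r *\<^sub>R S) o\<^sub>L B"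
      by (intro blinfun_eqI) (simp add: blinfun_apply_simps)
  qed
qed

text \<open>By commutation \<open>S + B\<close> annihilates \<open>\<eta> = (S - B) \<xi>\<close>.
  Both forms are nonnegative, so each vanishes at \<open>\<eta>\<close>, whence
  \<open>S \<eta> = B \<eta> = 0\<close> and \<open>\<eta>\<close> is orthogonal to itself.\<close>

lemma commuting_op_pos_sqrt_unique:
  assumes S: "op_pos S" and B: "op_pos B" and SB: "S o\<^sub>L S = B o\<^sub>L B" and comm: "B o\<^sub>L S = S o\<^sub>L B"
  shows "S = B"
proof (rule blinfun_eqI)
  fix \<xi>
  define \<eta> where "\<eta> = S \<xi> - B \<xi>"
  have SB': "S (S x) = B (B x)" for x using SB by (metis blinfun_apply_blinfun_compose)
  have comm': "B (S x) = S (B x)" for x using comm by (metis blinfun_apply_blinfun_compose)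
  have "S \<eta> + B \<eta> = 0" by (simp add: \<eta>_def blinfun_apply_simps SB' comm')
  then have "Re (cinner \<eta> (S \<eta>)) + Re (cinner \<eta> (B \<eta>)) = 0"
    by (metis cinner_add_right cinner_zero_right plus_complex.sel(1) zero_complex.sel(1))
  then have "Re (cinner \<eta> (S \<eta>)) = 0" "Re (cinner \<eta> (B \<eta>)) = 0"
    using op_pos_Re[OF S, of \<eta>] op_pos_Re[OF B, of \<eta>] by linarith+
  then have 0: "S \<eta> = 0" "B \<eta> = 0" using op_pos_apply_eq_0 S B by blast+
  have "cinner (S \<xi>) \<eta> = 0" "cinner (B \<xi>) \<eta> = 0"
    using S B by (simp_all add: hermitian_cinner op_pos_hermitian 0)
  then have "cinner \<eta> \<eta> = 0" by (simp add: \<eta>_def cinner_diff_left)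
  then show "S \<xi> = B \<xi>" by (simp add: cinner_eq_zero_iff \<eta>_def)
qed

text \<open>The constructed root commutes with everything that commutes with the square, in
  particular with \<open>A\<close> and with \<open>B\<close>; both therefore coincide with it,
  although they are not known to commute with each other.\<close>

lemma op_pos_sqrt_unique:
  assumes A: "op_pos A" and B: "op_pos B" and AB: "A o\<^sub>L A = B o\<^sub>L B"
  shows "A = B"
proof -
  have "op_pos (A o\<^sub>L A)"
    using op_pos_adj_compose[OF op_pos_BH[OF A]] op_pos_hermitian[OF A] by (simp add: hermitian_def)
  then obtain S where S: "op_pos S" "S o\<^sub>L S = A o\<^sub>L A"
    and comm: "\<And>C. C o\<^sub>L (A o\<^sub>L A) = (A o\<^sub>L A) o\<^sub>L C \<Longrightarrow> C o\<^sub>L S = S o\<^sub>L C"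
    using op_pos_sqrt_exists by blast
  have "S = A" by (rule commuting_op_pos_sqrt_unique[OF S(1) A S(2) comm]) (simp add: blinfun_compose_assoc)
  moreover have "S = B"
    by (rule commuting_op_pos_sqrt_unique[OF S(1) B]) (use S comm[of B] AB in \<open>simp_all add: blinfun_compose_assoc\<close>)
  ultimately show ?thesis by simp
qed

lemma op_abs_eqI: "op_pos B \<Longrightarrow> B o\<^sub>L B = adj A o\<^sub>L A \<Longrightarrow> op_abs A = B"
  unfolding op_abs_def by (rule the_equality) (simp, metis op_pos_sqrt_unique)

text \<open>The commutation clause later places \<open>op_abs A\<close> in \<open>M\<close> through
  the bicommutant, and makes the modulus of a hermitian operator commute with that operator.\<close>

lemma op_abs_properties:
  assumes "A \<in> BH"
  shows op_abs_pos: "op_pos (op_abs A)"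
    and op_abs_square: "op_abs A o\<^sub>L op_abs A = adj A o\<^sub>L A"
    and op_abs_commute: "B o\<^sub>L (adj A o\<^sub>L A) = (adj A o\<^sub>L A) o\<^sub>L B \<Longrightarrow> B o\<^sub>L op_abs A = op_abs A o\<^sub>L B"
proof -
  obtain S where S: "op_pos S" "S o\<^sub>L S = adj A o\<^sub>L A"
    and comm: "\<And>B. B o\<^sub>L (adj A o\<^sub>L A) = (adj A o\<^sub>L A) o\<^sub>L B \<Longrightarrow> B o\<^sub>L S = S o\<^sub>L B"
    by (rule op_pos_sqrt_exists[OF op_pos_adj_compose[OF assms]]) (rule that)
  have eq: "op_abs A = S" by (rule op_abs_eqI[OF S])
  show "op_pos (op_abs A)" "op_abs A o\<^sub>L op_abs A = adj A o\<^sub>L A"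
    unfolding eq by (fact S)+
  show "B o\<^sub>L op_abs A = op_abs A o\<^sub>L B" if "B o\<^sub>L (adj A o\<^sub>L A) = (adj A o\<^sub>L A) o\<^sub>L B"
    unfolding eq by (rule comm[OF that])
qed

lemma op_abs_of_pos: "op_pos A \<Longrightarrow> op_abs A = A"
  using op_pos_hermitian[of A] by (intro op_abs_eqI) (auto simp: hermitian_def)

section \<open>Positive and negative parts, and spectral projections, from kernels\<close>

text \<open>The product of \<open>R + A\<close> and \<open>R - A\<close> vanishes, so
  \<open>R - A\<close> maps into the kernel of \<open>R + A\<close>; moving the self-adjoint
  \<open>R - A\<close> across the inner product shows that it kills every vector orthogonal to that
  kernel.\<close>

lemma hermitian_difference_kernel:
  assumes R: "hermitian R" and A: "hermitian A" and RA: "R o\<^sub>L R = A o\<^sub>L A" "R o\<^sub>L A = A o\<^sub>L R"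
    and \<eta>: "\<And>\<kappa>. blinfun_apply (R + A) \<kappa> = 0 \<Longrightarrow> cinner \<kappa> \<eta> = 0"
  shows "blinfun_apply R \<eta> = blinfun_apply A \<eta>"
proof -
  have RR: "R (R x) = A (A x)" for x using RA(1) by (metis blinfun_apply_blinfun_compose)
  have cm: "R (A x) = A (R x)" for x using RA(2) by (metis blinfun_apply_blinfun_compose)
  have "(R - A) \<eta> = 0"
  proof (rule cinner_ext)
    fix \<zeta>
    have "cinner ((R - A) \<zeta>) \<eta> = 0"
      by (rule \<eta>) (simp add: blinfun_apply_simps RR cm)
    then show "cinner \<zeta> ((R - A) \<eta>) = cinner \<zeta> 0"
      using hermitian_cinner[OF hermitian_diff[OF R A]] by simp
  qed
  then show ?thesis by (simp add: blinfun_apply_simps)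
qed

text \<open>On the kernel of \<open>R + A\<close> the operator \<open>R - A\<close> equals
  \<open>2 R\<close>, and on the orthogonal complement it is zero. With \<open>R\<close> the modulus
  of \<open>A\<close> this is the inequality between an operator and its modulus.\<close>

lemma op_pos_minus_of_square_eq:
  assumes R: "op_pos R" and A: "hermitian A" and RA: "R o\<^sub>L R = A o\<^sub>L A" "R o\<^sub>L A = A o\<^sub>L R"
  shows "op_pos (R - A)"
proof (rule op_posI)
  show herm: "hermitian (R - A)" using R A by (simp add: hermitian_diff op_pos_hermitian)
  fix \<xi>
  let ?S = "{x. (R + A) x = 0}"
  have RR: "R (R x) = A (A x)" for x using RA(1) by (metis blinfun_apply_blinfun_compose)
  have cm: "R (A x) = A (R x)" for x using RA(2) by (metis blinfun_apply_blinfun_compose)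
  have BH: "R + A \<in> BH" using R A by (simp add: op_pos_BH hermitian_BH)
  have "closed ?S" by (rule closed_Collect_eq) (intro continuous_intros)+
  moreover have "subspace ?S" by (auto simp: subspace_def blinfun.add_right blinfun.scaleR_right)
  ultimately obtain \<kappa> \<eta> where \<xi>: "\<xi> = \<kappa> + \<eta>" "\<kappa> \<in> ?S" and \<eta>: "\<And>r. r \<in> ?S \<Longrightarrow> cinner r \<eta> = 0"
    by (rule orthogonal_decomposition[where x = \<xi>]) (auto simp: BH_apply_scaleC[OF BH])
  have "R \<eta> = A \<eta>"
    by (rule hermitian_difference_kernel[OF op_pos_hermitian[OF R] A RA]) (use \<eta> in simp)
  moreover have A\<kappa>: "A \<kappa> = - R \<kappa>" using \<xi>(2) by (simp add: blinfun_apply_simps eq_neg_iff_add_eq_0 add.commute)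
  ultimately have D: "(R - A) \<xi> = 2 *\<^sub>R R \<kappa>" by (simp add: \<xi>(1) blinfun_apply_simps scaleR_2)
  \<comment> \<open>The kernel is invariant under \<open>R\<close>, which removes the cross term
    between \<open>\<eta>\<close> and \<open>R \<kappa>\<close>.\<close>
  have "R \<kappa> \<in> ?S" by (simp add: blinfun_apply_simps RR A\<kappa>)
  then have "cinner (R \<kappa>) \<eta> = 0" by (rule \<eta>)
  then have "Re (cinner \<eta> (R \<kappa>)) = 0" using Re_cinner_commute[of \<eta> "R \<kappa>"] by simp
  then show "0 \<le> Re (cinner \<xi> ((R - A) \<xi>))"
    unfolding D using op_pos_Re[OF R, of \<kappa>] by (simp add: \<xi>(1) cinner_simps)
qed

text \<open>The projection is built pointwise and made linear by uniqueness of the orthogonal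
  decomposition. Commutation with \<open>Z\<close> is asked of \<open>B\<close> and of
  \<open>adj B\<close>: the first keeps \<open>B\<close> inside the kernel, the second keeps it
  inside the orthogonal complement.\<close>

lemma kernel_projection:
  assumes Z: "Z \<in> BH"
  obtains e where "hermitian e" "e o\<^sub>L e = e" "Z o\<^sub>L e = 0"
    "\<And>\<kappa> x. blinfun_apply Z \<kappa> = 0 \<Longrightarrow> cinner \<kappa> (x - blinfun_apply e x) = 0"
    "\<And>B. B \<in> BH \<Longrightarrow> B o\<^sub>L Z = Z o\<^sub>L B \<Longrightarrow> adj B o\<^sub>L Z = Z o\<^sub>L adj B \<Longrightarrow> B o\<^sub>L e = e o\<^sub>L B"
proof -
  let ?S = "{x. Z x = 0}"
  have "\<exists>s. Z s = 0 \<and> (\<forall>r. Z r = 0 \<longrightarrow> cinner r (x - s) = 0)" for x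
  proof -
    have "closed ?S" by (rule closed_Collect_eq) (intro continuous_intros)+
    moreover have "subspace ?S" by (auto simp: subspace_def blinfun.add_right blinfun.scaleR_right)
    ultimately obtain s t where "x = s + t" "s \<in> ?S" "\<And>r. r \<in> ?S \<Longrightarrow> cinner r t = 0"
      by (rule orthogonal_decomposition[where x = x]) (auto simp: BH_apply_scaleC[OF Z])
    then show ?thesis by (intro exI[of _ s]) auto
  qed
  then obtain f where f: "\<And>x. Z (f x) = 0" and fo: "\<And>r x. Z r = 0 \<Longrightarrow> cinner r (x - f x) = 0"
    by metis
  have uniq: "s = f x" if "Z s = 0" "\<And>r. Z r = 0 \<Longrightarrow> cinner r (x - s) = 0" for s x
  proof -
    have Zd: "Z (s - f x) = 0" using that f by (simp add: blinfun.diff_right)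
    have "cinner (s - f x) (s - f x) = cinner (s - f x) (x - f x) - cinner (s - f x) (x - s)"
      by (simp add: cinner_simps)
    also have "\<dots> = 0" using that(2)[OF Zd] fo[OF Zd] by simp
    finally show ?thesis by (simp add: cinner_eq_zero_iff)
  qed
  have "bounded_linear f"
  proof (rule bounded_linear_intro[where K = 1])
    show "f (x + y) = f x + f y" for x y
    proof (rule uniq[symmetric])
      show "cinner r (x + y - (f x + f y)) = 0" if "Z r = 0" for r
        using fo[OF that, of x] fo[OF that, of y] by (simp add: cinner_simps)
    qed (simp add: blinfun.add_right f)
    show "f (c *\<^sub>R x) = c *\<^sub>R f x" for c x
    proof (rule uniq[symmetric])
      show "cinner r (c *\<^sub>R x - c *\<^sub>R f x) = 0" if "Z r = 0" for r
        using fo[OF that, of x] by (simp add: cinner_simps)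
    qed (simp add: blinfun.scaleR_right f)
    show "norm (f x) \<le> norm x * 1" for x
    proof (cases "f x = 0")
      case False
      have "(norm (f x))\<^sup>2 = Re (cinner (f x) x)"
        using fo[OF f, of x x] by (simp add: power2_norm_cinner cinner_simps)
      also have "\<dots> \<le> norm (f x) * norm x"
        using complex_Re_le_cmod cinner_Cauchy_Schwarz order_trans by blast
      finally show ?thesis using False by (simp add: power2_eq_square)
    qed simp
  qed
  then have e: "blinfun_apply (Blinfun f) = f" by (rule bounded_linear_Blinfun_apply)
  show ?thesis
  proof
    have *: "cinner (f x) y = cinner (f x) (f y)" for x y
      using fo[OF f, of x y] by (simp add: cinner_simps)
    show "hermitian (Blinfun f)"
    proof (rule hermitianI)
      show "Blinfun f \<in> BH"
      proof (rule BH_I)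
        fix c x
        have "f (c *\<^sub>C x) = c *\<^sub>C f x"
        proof (rule uniq[symmetric])
          show "cinner r (c *\<^sub>C x - c *\<^sub>C f x) = 0" if "Z r = 0" for r
            using fo[OF that, of x] by (simp add: cinner_simps)
        qed (simp add: BH_apply_scaleC[OF Z] f)
        then show "Blinfun f (c *\<^sub>C x) = c *\<^sub>C Blinfun f x" by (simp add: e)
      qed
      show "cinner (Blinfun f x) y = cinner x (Blinfun f y)" for x y
        unfolding e using *[of x y] *[of y x] cinner_commute[of x "f y"] cinner_commute[of "f x" "f y"]
        by metis
    qed
    have "f (f x) = f x" for x by (rule uniq[symmetric]) (simp_all add: f)
    then show "Blinfun f o\<^sub>L Blinfun f = Blinfun f" by (intro blinfun_eqI) (simp add: e)
    show "Z o\<^sub>L Blinfun f = 0" by (rule blinfun_eqI) (simp add: e f)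
    show "cinner \<kappa> (x - Blinfun f x) = 0" if "Z \<kappa> = 0" for \<kappa> x using fo[OF that] by (simp add: e)
    fix B assume B: "B \<in> BH" "B o\<^sub>L Z = Z o\<^sub>L B" "adj B o\<^sub>L Z = Z o\<^sub>L adj B"
    have B2: "Z (B x) = B (Z x)" for x using B(2) by (metis blinfun_apply_blinfun_compose)
    have B3: "Z (adj B x) = adj B (Z x)" for x using B(3) by (metis blinfun_apply_blinfun_compose)
    have "B (f x) = f (B x)" for x
    proof (rule uniq)
      show "Z (B (f x)) = 0" by (simp add: B2 f)
      fix r assume "Z r = 0"
      then have "Z (adj B r) = 0" by (simp add: B3)
      then have "cinner (adj B r) (x - f x) = 0" by (rule fo)
      then show "cinner r (B x - B (f x)) = 0"
        by (simp add: cinner_adj_left[OF B(1)] blinfun.diff_right)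
    qed
    then show "B o\<^sub>L Blinfun f = Blinfun f o\<^sub>L B" by (intro blinfun_eqI) (simp add: e)
  qed
qed

text \<open>\<open>e\<close> is the kernel projection of \<open>\<bar>x - K\<bar> + (x - K)\<close>, a spectral projection of \<open>x\<close> for
  \<open>(-\<infinity>, K]\<close>.\<close>

lemma spectral_cut:
  assumes x: "hermitian x"
  obtains e where "hermitian e" "e o\<^sub>L e = e" "e o\<^sub>L x = x o\<^sub>L e"
    "\<And>\<xi>. Re (cinner (blinfun_apply e \<xi>) (blinfun_apply x (blinfun_apply e \<xi>)))
      \<le> K * (norm (blinfun_apply e \<xi>))\<^sup>2"
    "\<And>\<xi>. K * (norm (\<xi> - blinfun_apply e \<xi>))\<^sup>2
      \<le> Re (cinner (\<xi> - blinfun_apply e \<xi>) (blinfun_apply x (\<xi> - blinfun_apply e \<xi>)))"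
    "\<And>B. B \<in> BH \<Longrightarrow> B o\<^sub>L x = x o\<^sub>L B \<Longrightarrow> adj B o\<^sub>L x = x o\<^sub>L adj B \<Longrightarrow> B o\<^sub>L e = e o\<^sub>L B"
proof -
  define A where "A = x - K *\<^sub>R id_blinfun"
  have A: "hermitian A" using x by (simp add: A_def hermitian_diff hermitian_scaleR)
  define R where "R = op_abs A"
  have AA: "adj A = A" using A by (simp add: hermitian_def)
  have R: "op_pos R" unfolding R_def by (rule op_abs_pos[OF hermitian_BH[OF A]])
  have RR: "R o\<^sub>L R = A o\<^sub>L A"
    using op_abs_square[OF hermitian_BH[OF A]] by (simp only: R_def AA)
  have Rcomm: "B o\<^sub>L R = R o\<^sub>L B" if "B o\<^sub>L (A o\<^sub>L A) = (A o\<^sub>L A) o\<^sub>L B" for B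
    using op_abs_commute[OF hermitian_BH[OF A], of B] that by (simp only: R_def AA)
  have RA: "R o\<^sub>L A = A o\<^sub>L R" by (rule Rcomm[symmetric]) (simp add: blinfun_compose_assoc)
  have BH: "R + A \<in> BH" using R A by (simp add: op_pos_BH hermitian_BH)
  obtain e where e: "hermitian e" "e o\<^sub>L e = e" "(R + A) o\<^sub>L e = 0"
    "\<And>\<kappa> x. blinfun_apply (R + A) \<kappa> = 0 \<Longrightarrow> cinner \<kappa> (x - blinfun_apply e x) = 0"
    and ecomm: "\<And>B. B \<in> BH \<Longrightarrow> B o\<^sub>L (R + A) = (R + A) o\<^sub>L B \<Longrightarrow>
      adj B o\<^sub>L (R + A) = (R + A) o\<^sub>L adj B \<Longrightarrow> B o\<^sub>L e = e o\<^sub>L B"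
    by (rule kernel_projection[OF BH]) (rule that)
  have Ax: "Re (cinner \<zeta> (x \<zeta>)) = Re (cinner \<zeta> (A \<zeta>)) + K * (norm \<zeta>)\<^sup>2" for \<zeta>
    by (simp add: A_def blinfun_apply_simps cinner_simps cinner_self)
  have RAcomm: "B o\<^sub>L (R + A) = (R + A) o\<^sub>L B" if "B o\<^sub>L x = x o\<^sub>L B" for B
  proof -
    have "B (x \<xi>) = x (B \<xi>)" for \<xi> using that by (metis blinfun_apply_blinfun_compose)
    then have BA: "B (A \<xi>) = A (B \<xi>)" for \<xi> by (simp add: A_def blinfun_apply_simps)
    then have "B o\<^sub>L R = R o\<^sub>L B" by (intro Rcomm blinfun_eqI) simp
    then have "B (R \<xi>) = R (B \<xi>)" for \<xi> by (metis blinfun_apply_blinfun_compose)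
    with BA show ?thesis by (intro blinfun_eqI) (simp add: blinfun_apply_simps)
  qed
  have comm: "B o\<^sub>L e = e o\<^sub>L B"
    if "B \<in> BH" "B o\<^sub>L x = x o\<^sub>L B" "adj B o\<^sub>L x = x o\<^sub>L adj B" for B
    using ecomm[OF that(1) RAcomm RAcomm] that by blast
  have "x o\<^sub>L e = e o\<^sub>L x"
    using x by (intro comm) (simp_all add: hermitian_def)
  then have "e o\<^sub>L x = x o\<^sub>L e" by (rule sym)
  \<comment> \<open>On the range of \<open>e\<close>, \<open>A = - R\<close> has a nonpositive form;
    on the complement, treated next, \<open>A = R\<close> has a nonnegative one. Adding
    \<open>K\<close> back gives the two bounds on \<open>x\<close>.\<close>
  moreover have "Re (cinner (e \<xi>) (x (e \<xi>))) \<le> K * (norm (e \<xi>))\<^sup>2" for \<xi>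
  proof -
    have "(R + A) (e \<xi>) = 0" using e(3) by (metis blinfun_apply_blinfun_compose zero_blinfun.rep_eq)
    then have "A (e \<xi>) = - R (e \<xi>)" by (simp add: blinfun_apply_simps eq_neg_iff_add_eq_0 add.commute)
    then show ?thesis using Ax[of "e \<xi>"] op_pos_Re[OF R, of "e \<xi>"] by (simp add: cinner_simps)
  qed
  moreover have "K * (norm (\<xi> - e \<xi>))\<^sup>2 \<le> Re (cinner (\<xi> - e \<xi>) (x (\<xi> - e \<xi>)))" for \<xi>
  proof -
    have "R (\<xi> - e \<xi>) = A (\<xi> - e \<xi>)"
      by (rule hermitian_difference_kernel[OF op_pos_hermitian[OF R] A RR RA]) (rule e(4))
    then show ?thesis using Ax[of "\<xi> - e \<xi>"] op_pos_Re[OF R, of "\<xi> - e \<xi>"] by simp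
  qed
  ultimately show ?thesis using e(1,2) comm by (intro that[of e])
qed

section \<open>Von Neumann algebras\<close>

lemma blinfun_compose_add: "A o\<^sub>L (B + C) = (A o\<^sub>L B) + (A o\<^sub>L C)"
    "(A + B) o\<^sub>L C = (A o\<^sub>L C) + (B o\<^sub>L C)"
  by (rule blinfun_eqI, simp add: blinfun_apply_simps)+

lemma blinfun_compose_diff: "A o\<^sub>L (B - C) = (A o\<^sub>L B) - (A o\<^sub>L C)"
    "(A - B) o\<^sub>L C = (A o\<^sub>L C) - (B o\<^sub>L C)"
  by (rule blinfun_eqI, simp add: blinfun_apply_simps)+

lemma blinfun_compose_scaleR: "A o\<^sub>L (r *\<^sub>R B) = r *\<^sub>R (A o\<^sub>L B)"
    "(r *\<^sub>R A) o\<^sub>L B = r *\<^sub>R (A o\<^sub>L B)"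
  by (rule blinfun_eqI, simp add: blinfun_apply_simps)+

lemma blinfun_compose_scaleC: "A \<in> BH \<Longrightarrow> A o\<^sub>L (c *\<^sub>C B) = c *\<^sub>C (A o\<^sub>L B)"
    "(c *\<^sub>C A) o\<^sub>L B = c *\<^sub>C (A o\<^sub>L B)"
  by (rule blinfun_eqI, simp add: BH_apply_scaleC)+

lemmas blinfun_compose_simps = blinfun_compose_add blinfun_compose_diff blinfun_compose_scaleR

lemma norm_adj_le:
  assumes "A \<in> BH"
  shows "norm (adj A) \<le> norm A"
proof (rule norm_blinfun_bound)
  fix \<xi>
  show "norm (adj A \<xi>) \<le> norm A * norm \<xi>"
  proof (cases "adj A \<xi> = 0")
    case False
    have "(norm (adj A \<xi>))\<^sup>2 = Re (cinner (adj A \<xi>) (adj A \<xi>))" by (rule power2_norm_cinner)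
    also have "\<dots> = Re (cinner (A (adj A \<xi>)) \<xi>)"
      by (simp add: cinner_adj_right[OF assms])
    also have "\<dots> \<le> norm (A (adj A \<xi>)) * norm \<xi>"
      by (rule order_trans[OF complex_Re_le_cmod cinner_Cauchy_Schwarz])
    also have "\<dots> \<le> norm A * norm (adj A \<xi>) * norm \<xi>"
      by (intro mult_right_mono norm_blinfun) simp
    finally show ?thesis using False by (simp add: power2_eq_square mult.assoc mult.left_commute)
  qed simp
qed simp

lemma op_pos_minus_adj_compose:
  assumes A: "A \<in> BH" and K: "norm A \<le> K"
  shows "op_pos (K\<^sup>2 *\<^sub>R id_blinfun - (adj A o\<^sub>L A))"
proof (rule hermitian_norm_bound)
  show "hermitian (adj A o\<^sub>L A)" using A by (intro op_pos_hermitian op_pos_adj_compose)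
  have "norm (adj A o\<^sub>L A) \<le> norm (adj A) * norm A" by (rule norm_blinfun_compose)
  also have "\<dots> \<le> K * K"
    using norm_adj_le[OF A] K norm_ge_zero[of A] by (intro mult_mono) linarith+
  finally show "norm (adj A o\<^sub>L A) \<le> K\<^sup>2" by (simp add: power2_eq_square)
qed

lemma norm_one_minus_adj_compose:
  assumes A: "A \<in> BH" and n: "norm A \<le> 1"
  shows "hermitian (id_blinfun - (adj A o\<^sub>L A))" "norm (id_blinfun - (adj A o\<^sub>L A)) \<le> 1"
proof -
  have P: "op_pos (id_blinfun - (adj A o\<^sub>L A))"
    using op_pos_minus_adj_compose[OF A n] by simp
  then show "hermitian (id_blinfun - (adj A o\<^sub>L A))" by (rule op_pos_hermitian)
  show "norm (id_blinfun - (adj A o\<^sub>L A)) \<le> 1"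
    by (rule op_pos_norm_le[OF P]) (use A in \<open>simp_all add: op_pos_adj_compose\<close>)
qed

locale von_neumann =
  fixes M :: "('h::complex_hilbert_space \<Rightarrow>\<^sub>L 'h) set"
  assumes vna: "von_neumann_algebra M"
begin

lemma M_BH: "A \<in> M \<Longrightarrow> A \<in> BH"
  using vna by (auto simp: von_neumann_algebra_def)

lemma M_adj: "A \<in> M \<Longrightarrow> adj A \<in> M"
  using vna by (auto simp: von_neumann_algebra_def)

lemma M_commutant: "A \<in> M \<Longrightarrow> B \<in> commutant M \<Longrightarrow> A o\<^sub>L B = B o\<^sub>L A"
  by (simp add: commutant_def)

text \<open>The bicommutant condition as a membership test. The algebraic closure properties of
  \<open>M\<close>, and the membership of moduli and spectral projections, come from it.\<close>

lemma M_memI: "A \<in> BH \<Longrightarrow> (\<And>B. B \<in> commutant M \<Longrightarrow> A o\<^sub>L B = B o\<^sub>L A) \<Longrightarrow> A \<in> M"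
proof -
  assume "A \<in> BH" "\<And>B. B \<in> commutant M \<Longrightarrow> A o\<^sub>L B = B o\<^sub>L A"
  then have "A \<in> commutant (commutant M)" unfolding commutant_def[of "commutant M"] by blast
  then show "A \<in> M" using vna by (simp add: von_neumann_algebra_def)
qed

lemma commutant_BH: "B \<in> commutant M \<Longrightarrow> B \<in> BH"
  by (simp add: commutant_def)

text \<open>Holds because \<open>M\<close> is closed under \<open>adj\<close>. It is needed for
  \<open>kernel_projection\<close>, where an operator and its adjoint must both commute.\<close>

lemma commutant_adj:
  assumes B: "B \<in> commutant M"
  shows "adj B \<in> commutant M"
proof -
  have "adj B o\<^sub>L A = A o\<^sub>L adj B" if A: "A \<in> M" for A
  proof -
    have "adj (adj A o\<^sub>L B) = adj (B o\<^sub>L adj A)" using M_commutant[OF M_adj[OF A] B] by simp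
    then show ?thesis using A B by (simp add: adj_compose M_BH commutant_BH)
  qed
  then show ?thesis using B by (simp add: commutant_def)
qed

lemma M_id: "id_blinfun \<in> M"
  by (rule M_memI) simp_all

lemma M_compose: "A \<in> M \<Longrightarrow> B \<in> M \<Longrightarrow> A o\<^sub>L B \<in> M"
  by (rule M_memI) (simp add: M_BH, metis M_commutant blinfun_compose_assoc)

lemma M_add: "A \<in> M \<Longrightarrow> B \<in> M \<Longrightarrow> A + B \<in> M"
  by (rule M_memI) (simp_all add: M_BH M_commutant blinfun_compose_add)

lemma M_scaleC: "A \<in> M \<Longrightarrow> c *\<^sub>C A \<in> M"
  by (rule M_memI) (simp_all add: M_BH M_commutant blinfun_compose_scaleC commutant_BH)

lemma M_scaleR: "A \<in> M \<Longrightarrow> r *\<^sub>R A \<in> M"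
  by (metis M_scaleC scaleC_of_real)

lemma M_diff: "A \<in> M \<Longrightarrow> B \<in> M \<Longrightarrow> A - B \<in> M"
  using M_add[of A "(- 1) *\<^sub>R B"] M_scaleR[of B "- 1"] by simp

lemma M_zero: "0 \<in> M"
  using M_diff[OF M_id M_id] by simp

lemmas M_intros = M_id M_compose M_add M_scaleC M_scaleR M_diff M_zero M_adj

lemma subspace_M: "subspace M"
  by (simp add: subspace_def M_zero M_add M_scaleR)

lemma M_op_abs:
  assumes "A \<in> M"
  shows "op_abs A \<in> M"
proof (rule M_memI)
  show "op_abs A \<in> BH" using assms by (intro op_pos_BH op_abs_pos M_BH)
  fix B assume B: "B \<in> commutant M"
  have "adj A o\<^sub>L A \<in> M" using assms by (intro M_intros)
  then have "(adj A o\<^sub>L A) o\<^sub>L B = B o\<^sub>L (adj A o\<^sub>L A)" using B by (rule M_commutant)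
  then show "op_abs A o\<^sub>L B = B o\<^sub>L op_abs A"
    using op_abs_commute[OF M_BH[OF assms], of B] by simp
qed

lemma M_sqrt_iter: "T \<in> M \<Longrightarrow> sqrt_iter T n \<in> M"
  by (induction n) (simp_all add: M_intros)

lemma spectral_cut_in_M:
  assumes x: "hermitian x" "x \<in> M"
  obtains e where "e \<in> M" "hermitian e" "e o\<^sub>L e = e" "e o\<^sub>L x = x o\<^sub>L e"
    "\<And>\<xi>. Re (cinner (blinfun_apply e \<xi>) (blinfun_apply x (blinfun_apply e \<xi>)))
      \<le> K * (norm (blinfun_apply e \<xi>))\<^sup>2"
    "\<And>\<xi>. K * (norm (\<xi> - blinfun_apply e \<xi>))\<^sup>2
      \<le> Re (cinner (\<xi> - blinfun_apply e \<xi>) (blinfun_apply x (\<xi> - blinfun_apply e \<xi>)))"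
proof (rule spectral_cut[OF x(1), of K])
  fix e
  assume e: "hermitian e" "e o\<^sub>L e = e" "e o\<^sub>L x = x o\<^sub>L e"
    "\<And>\<xi>. Re (cinner (blinfun_apply e \<xi>) (blinfun_apply x (blinfun_apply e \<xi>)))
      \<le> K * (norm (blinfun_apply e \<xi>))\<^sup>2"
    "\<And>\<xi>. K * (norm (\<xi> - blinfun_apply e \<xi>))\<^sup>2
      \<le> Re (cinner (\<xi> - blinfun_apply e \<xi>) (blinfun_apply x (\<xi> - blinfun_apply e \<xi>)))"
    and comm: "\<And>B. B \<in> BH \<Longrightarrow> B o\<^sub>L x = x o\<^sub>L B \<Longrightarrow> adj B o\<^sub>L x = x o\<^sub>L adj B \<Longrightarrow> B o\<^sub>L e = e o\<^sub>L B"
  have "e \<in> M"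
  proof (rule M_memI)
    show "e \<in> BH" by (rule hermitian_BH[OF e(1)])
    fix B assume B: "B \<in> commutant M"
    have "B o\<^sub>L e = e o\<^sub>L B"
      by (rule comm[OF commutant_BH[OF B] M_commutant[OF x(2) B, symmetric]
            M_commutant[OF x(2) commutant_adj[OF B], symmetric]])
    then show "e o\<^sub>L B = B o\<^sub>L e" by (rule sym)
  qed
  then show ?thesis by (rule that[OF _ e])
qed

end

section \<open>Traces and the norm of L1\<close>

lemma quadratic_discriminant_nonneg:
  fixes a b c :: real
  assumes nonneg: "\<And>t. 0 \<le> a - 2 * t * b + t\<^sup>2 * c" and c: "0 \<le> c"
  shows "b\<^sup>2 \<le> c * a"
proof (cases "c = 0")
  case True
  have "b = 0"
  proof (rule ccontr)
    assume "b \<noteq> 0"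
    \<comment> \<open>For \<open>c = 0\<close> the expression is affine in \<open>t\<close> and
      takes the value \<open>- 1\<close> at this point.\<close>
    then show False using nonneg[of "(a + 1) / (2 * b)"] True by simp
  qed
  then show ?thesis using True by simp
next
  case False
  then have "0 \<le> (a - 2 * (b / c) * b + (b / c)\<^sup>2 * c) * c" using nonneg[of "b / c"] c by simp
  also have "\<dots> = c * a - b\<^sup>2" using False by (simp add: field_simps power2_eq_square)
  finally show ?thesis by simp
qed

locale tracial_L1 = von_neumann M
  for M :: "('h::complex_hilbert_space \<Rightarrow>\<^sub>L 'h) set" +
  fixes \<tau> :: "('h \<Rightarrow>\<^sub>L 'h) \<Rightarrow> complex" and \<iota> :: "('h \<Rightarrow>\<^sub>L 'h) \<Rightarrow> 'l::complex_banach"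
  assumes trace: "finite_trace M \<tau>" and compl: "L1_completion M \<tau> \<iota>"
begin

lemma \<tau>_add: "A \<in> M \<Longrightarrow> B \<in> M \<Longrightarrow> \<tau> (A + B) = \<tau> A + \<tau> B"
  using trace by (simp add: finite_trace_def)

lemma \<tau>_scaleC: "A \<in> M \<Longrightarrow> \<tau> (c *\<^sub>C A) = c * \<tau> A"
  using trace by (simp add: finite_trace_def)

lemma \<tau>_scaleR: "A \<in> M \<Longrightarrow> \<tau> (r *\<^sub>R A) = of_real r * \<tau> A"
  by (metis \<tau>_scaleC scaleC_of_real)

lemma \<tau>_diff: "A \<in> M \<Longrightarrow> B \<in> M \<Longrightarrow> \<tau> (A - B) = \<tau> A - \<tau> B"
  using \<tau>_add[of A "(- 1) *\<^sub>R B"] M_scaleR[of B "- 1"] \<tau>_scaleR[of B "- 1"] by simp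

lemma \<tau>_commute: "A \<in> M \<Longrightarrow> B \<in> M \<Longrightarrow> \<tau> (A o\<^sub>L B) = \<tau> (B o\<^sub>L A)"
  using trace by (simp add: finite_trace_def)

lemma \<tau>_pos: "A \<in> M \<Longrightarrow> op_pos A \<Longrightarrow> 0 \<le> Re (\<tau> A) \<and> Im (\<tau> A) = 0"
  using trace by (simp add: finite_trace_def positives_def complex_nonneg_Reals_iff)

lemma \<tau>_mono: "A \<in> M \<Longrightarrow> B \<in> M \<Longrightarrow> op_pos (B - A) \<Longrightarrow> Re (\<tau> A) \<le> Re (\<tau> B)"
  using \<tau>_pos[of "B - A"] by (simp add: M_diff \<tau>_diff)

lemma \<iota>_add: "A \<in> M \<Longrightarrow> B \<in> M \<Longrightarrow> \<iota> (A + B) = \<iota> A + \<iota> B"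
  using compl by (simp add: L1_completion_def)

lemma \<iota>_scaleC: "A \<in> M \<Longrightarrow> \<iota> (c *\<^sub>C A) = c *\<^sub>C \<iota> A"
  using compl by (simp add: L1_completion_def)

lemma \<iota>_scaleR: "A \<in> M \<Longrightarrow> \<iota> (r *\<^sub>R A) = r *\<^sub>R \<iota> A"
  by (metis \<iota>_scaleC scaleC_of_real)

lemma \<iota>_diff: "A \<in> M \<Longrightarrow> B \<in> M \<Longrightarrow> \<iota> (A - B) = \<iota> A - \<iota> B"
  using \<iota>_add[of A "(- 1) *\<^sub>R B"] M_scaleR[of B "- 1"] \<iota>_scaleR[of B "- 1"] by simp

lemma norm_\<iota>: "A \<in> M \<Longrightarrow> norm (\<iota> A) = Re (\<tau> (op_abs A))"
  using compl by (simp add: L1_completion_def)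

lemma norm_\<iota>_pos: "A \<in> M \<Longrightarrow> op_pos A \<Longrightarrow> norm (\<iota> A) = Re (\<tau> A)"
  by (simp add: norm_\<iota> op_abs_of_pos)

text \<open>Both \<open>A\<close> and \<open>- A\<close> lie below the modulus, which bounds the
  real part. The trace is real because \<open>A\<close> is the difference of the positive operators
  \<open>op_abs A\<close> and \<open>op_abs A - A\<close>.\<close>

lemma \<tau>_hermitian:
  assumes A: "A \<in> M" "hermitian A"
  shows "\<bar>Re (\<tau> A)\<bar> \<le> norm (\<iota> A)" "Im (\<tau> A) = 0"
proof -
  let ?R = "op_abs A"
  have R: "?R \<in> M" "op_pos ?R" using A by (simp_all add: M_op_abs op_abs_pos M_BH)
  have sq: "?R o\<^sub>L ?R = A o\<^sub>L A" using op_abs_square[OF M_BH[OF A(1)]] A(2) by (simp add: hermitian_def)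
  have comm: "?R o\<^sub>L A = A o\<^sub>L ?R"
    by (rule op_abs_commute[OF M_BH[OF A(1)], symmetric])
      (use A(2) in \<open>simp add: hermitian_def blinfun_compose_assoc\<close>)
  have P1: "op_pos (?R - A)" by (rule op_pos_minus_of_square_eq[OF R(2) A(2) sq comm])
  have A': "hermitian ((- 1) *\<^sub>R A)" by (rule hermitian_scaleR[OF A(2)])
  have P2: "op_pos (?R - (- 1) *\<^sub>R A)"
    by (rule op_pos_minus_of_square_eq[OF R(2) A'])
      (simp_all only: blinfun_compose_scaleR sq comm scaleR_scaleR, simp)
  have nA: "(- 1) *\<^sub>R A \<in> M" using A by (intro M_intros)
  have "Re (\<tau> A) \<le> Re (\<tau> ?R)" by (rule \<tau>_mono[OF A(1) R(1) P1])
  moreover have "Re (\<tau> ((- 1) *\<^sub>R A)) \<le> Re (\<tau> ?R)" by (rule \<tau>_mono[OF nA R(1) P2])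
  ultimately show "\<bar>Re (\<tau> A)\<bar> \<le> norm (\<iota> A)"
    unfolding norm_\<iota>[OF A(1)] \<tau>_scaleR[OF A(1)] by simp
  have "Im (\<tau> ?R) = 0" "Im (\<tau> (?R - A)) = 0"
    using \<tau>_pos[OF R] \<tau>_pos[OF M_diff[OF R(1) A(1)] P1] by auto
  then show "Im (\<tau> A) = 0" using R(1) A(1) by (simp add: \<tau>_diff)
qed

text \<open>From \<open>- r \<le> A \<le> r\<close> and monotonicity. This continuity in operator
  norm lets the trace pass to the limit of the square root iterates.\<close>

lemma \<tau>_hermitian_norm:
  assumes A: "A \<in> M" "hermitian A" and r: "norm A \<le> r"
  shows "\<bar>Re (\<tau> A)\<bar> \<le> r * Re (\<tau> id_blinfun)"
proof -
  have rI: "r *\<^sub>R id_blinfun \<in> M" by (intro M_intros)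
  have A': "(- 1) *\<^sub>R A \<in> M" "hermitian ((- 1) *\<^sub>R A)" "norm ((- 1) *\<^sub>R A) \<le> r"
    using M_scaleR[OF A(1), of "- 1"] hermitian_scaleR[OF A(2), of "- 1"] r by simp_all
  have "Re (\<tau> A) \<le> Re (\<tau> (r *\<^sub>R id_blinfun))"
    by (rule \<tau>_mono[OF A(1) rI hermitian_norm_bound[OF A(2) r]])
  moreover have "Re (\<tau> ((- 1) *\<^sub>R A)) \<le> Re (\<tau> (r *\<^sub>R id_blinfun))"
    by (rule \<tau>_mono[OF A'(1) rI hermitian_norm_bound[OF A'(2,3)]])
  ultimately show ?thesis unfolding \<tau>_scaleR[OF A(1)] \<tau>_scaleR[OF M_id] by simp
qed

lemma \<tau>_LIMSEQ:
  assumes X: "\<And>n. X n \<in> M" "\<And>n. hermitian (X n)" and L: "L \<in> M" "hermitian L"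
    and lim: "X \<longlonglongrightarrow> L"
  shows "(\<lambda>n. Re (\<tau> (X n))) \<longlonglongrightarrow> Re (\<tau> L)"
proof (rule LIM_zero_cancel, rule Lim_null_comparison)
  show "\<forall>\<^sub>F n in sequentially. norm (Re (\<tau> (X n)) - Re (\<tau> L)) \<le> norm (X n - L) * Re (\<tau> id_blinfun)"
  proof (rule always_eventually, rule allI)
    fix n
    show "norm (Re (\<tau> (X n)) - Re (\<tau> L)) \<le> norm (X n - L) * Re (\<tau> id_blinfun)"
      using \<tau>_hermitian_norm[OF M_diff[OF X(1) L(1)] hermitian_diff[OF X(2) L(2)] order_refl, of n]
      by (simp add: \<tau>_diff X L)
  qed
  have "(\<lambda>n. norm (X n - L) * Re (\<tau> id_blinfun)) \<longlonglongrightarrow> 0 * Re (\<tau> id_blinfun)"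
    by (intro tendsto_mult tendsto_norm_zero LIM_zero lim tendsto_const)
  then show "(\<lambda>n. norm (X n - L) * Re (\<tau> id_blinfun)) \<longlonglongrightarrow> 0" by simp
qed

section \<open>Invariance of the \<open>L\<^sup>1\<close> norm under the adjoint, and continuity of
  the trace\<close>

text \<open>Both iterations are polynomials in \<open>A A\<^sup>*\<close> resp. \<open>A\<^sup>* A\<close>; the witness \<open>G\<close> displays their
  non-constant parts as \<open>A G A\<^sup>*\<close> and \<open>A\<^sup>* A G\<close>, which have the same trace.\<close>

lemma sqrt_iter_intertwine:
  assumes A: "A \<in> M"
  shows "\<exists>G\<in>M. sqrt_iter (id_blinfun - (A o\<^sub>L adj A)) n
      = sqrt_majorant n *\<^sub>R id_blinfun - (A o\<^sub>L (G o\<^sub>L adj A))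
    \<and> sqrt_iter (id_blinfun - (adj A o\<^sub>L A)) n
      = sqrt_majorant n *\<^sub>R id_blinfun - ((adj A o\<^sub>L A) o\<^sub>L G)"
proof (induction n)
  case 0
  then show ?case by (intro bexI[of _ 0]) (simp_all add: M_zero blinfun_eqI)
next
  case (Suc n)
  then obtain G where G: "G \<in> M"
    and 1: "sqrt_iter (id_blinfun - (A o\<^sub>L adj A)) n
      = sqrt_majorant n *\<^sub>R id_blinfun - (A o\<^sub>L (G o\<^sub>L adj A))"
    and 2: "sqrt_iter (id_blinfun - (adj A o\<^sub>L A)) n
      = sqrt_majorant n *\<^sub>R id_blinfun - ((adj A o\<^sub>L A) o\<^sub>L G)"
    by blast
  define y where "y = sqrt_majorant n"
  \<comment> \<open>Read off by inserting \<open>y - A G A'\<close> (with \<open>A'\<close> the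
    adjoint) into \<open>(T + Y\<^sup>2) / 2\<close>: the constant is
    \<open>(1 + y\<^sup>2) / 2\<close>, and the rest factors through \<open>A\<close> and
    \<open>A'\<close> with this middle term. The same \<open>H\<close> serves the second
    iteration.\<close>
  define H where "H = (1 / 2) *\<^sub>R (id_blinfun + (y *\<^sub>R G + y *\<^sub>R G) - (G o\<^sub>L ((adj A o\<^sub>L A) o\<^sub>L G)))"
  have "H \<in> M" unfolding H_def using A G by (intro M_intros)
  moreover have "sqrt_iter (id_blinfun - (A o\<^sub>L adj A)) (Suc n)
      = sqrt_majorant (Suc n) *\<^sub>R id_blinfun - (A o\<^sub>L (H o\<^sub>L adj A))"
    unfolding sqrt_iter.simps 1 sqrt_majorant.simps y_def[symmetric] H_def
    by (rule blinfun_eqI) (simp add: blinfun_apply_simps algebra_simps power2_eq_square add_divide_distrib)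
  moreover have "sqrt_iter (id_blinfun - (adj A o\<^sub>L A)) (Suc n)
      = sqrt_majorant (Suc n) *\<^sub>R id_blinfun - ((adj A o\<^sub>L A) o\<^sub>L H)"
    unfolding sqrt_iter.simps 2 sqrt_majorant.simps y_def[symmetric] H_def
    by (rule blinfun_eqI) (simp add: blinfun_apply_simps algebra_simps power2_eq_square add_divide_distrib)
  ultimately show ?case by blast
qed

text \<open>The moduli of \<open>A\<close> and \<open>adj A\<close> are norm limits of
  \<open>id_blinfun - sqrt_iter T n\<close> and \<open>id_blinfun - sqrt_iter T' n\<close>, whose
  traces agree for every \<open>n\<close> by traciality. The norm hypothesis lets the iterations
  converge; \<open>norm_\<iota>_adj\<close> removes it by scaling.\<close>

lemma norm_\<iota>_adj_contraction:
  assumes A: "A \<in> M" and n: "norm A \<le> 1"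
  shows "norm (\<iota> (adj A)) = norm (\<iota> A)"
proof -
  have BH: "A \<in> BH" "adj A \<in> BH" using A by (simp_all add: M_BH)
  define T where "T = id_blinfun - (adj A o\<^sub>L A)"
  define T' where "T' = id_blinfun - (A o\<^sub>L adj A)"
  have TM: "T \<in> M" "T' \<in> M" unfolding T_def T'_def by (intro M_intros A)+
  have T: "hermitian T" "norm T \<le> 1"
    unfolding T_def using norm_one_minus_adj_compose[OF BH(1) n] by blast+
  have n': "norm (adj A) \<le> 1" using norm_adj_le[OF BH(1)] n by simp
  have T': "hermitian T'" "norm T' \<le> 1"
    unfolding T'_def using norm_one_minus_adj_compose[OF BH(2) n'] BH by simp_all
  have TT: "id_blinfun - T = adj A o\<^sub>L A" "id_blinfun - T' = A o\<^sub>L adj A"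
    by (simp_all add: T_def T'_def)
  obtain S where S: "op_pos S" "S o\<^sub>L S = id_blinfun - T"
    "(\<lambda>n. id_blinfun - sqrt_iter T n) \<longlonglongrightarrow> S" by (rule sqrt_one_minus[OF T])
  obtain S' where S': "op_pos S'" "S' o\<^sub>L S' = id_blinfun - T'"
    "(\<lambda>n. id_blinfun - sqrt_iter T' n) \<longlonglongrightarrow> S'" by (rule sqrt_one_minus[OF T'])
  have SA: "op_abs A = S" using S(1,2) unfolding TT by (rule op_abs_eqI)
  have SA': "op_abs (adj A) = S'" using S'(1,2) unfolding TT by (intro op_abs_eqI) (simp_all add: BH)
  have SM: "S \<in> M" "S' \<in> M" using M_op_abs[OF A] M_op_abs[OF M_adj[OF A]] SA SA' by simp_all
  have eq: "\<tau> (id_blinfun - sqrt_iter T' n) = \<tau> (id_blinfun - sqrt_iter T n)" for n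
  proof -
    obtain G where G: "G \<in> M"
      and 1: "sqrt_iter T' n = sqrt_majorant n *\<^sub>R id_blinfun - (A o\<^sub>L (G o\<^sub>L adj A))"
      and 2: "sqrt_iter T n = sqrt_majorant n *\<^sub>R id_blinfun - ((adj A o\<^sub>L A) o\<^sub>L G)"
      using sqrt_iter_intertwine[OF A, of n] unfolding T_def T'_def by blast
    have "\<tau> (A o\<^sub>L (G o\<^sub>L adj A)) = \<tau> ((G o\<^sub>L adj A) o\<^sub>L A)"
      using A G by (intro \<tau>_commute M_intros)
    also have "\<dots> = \<tau> (G o\<^sub>L (adj A o\<^sub>L A))" by (simp only: blinfun_compose_assoc)
    also have "\<dots> = \<tau> ((adj A o\<^sub>L A) o\<^sub>L G)"
      using A G by (intro \<tau>_commute M_intros)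
    finally have "\<tau> (A o\<^sub>L (G o\<^sub>L adj A)) = \<tau> ((adj A o\<^sub>L A) o\<^sub>L G)" .
    then show ?thesis unfolding 1 2 using A G by (simp add: \<tau>_diff M_intros)
  qed
  have "(\<lambda>n. Re (\<tau> (id_blinfun - sqrt_iter T n))) \<longlonglongrightarrow> Re (\<tau> S)"
    by (rule \<tau>_LIMSEQ[OF _ _ SM(1) op_pos_hermitian[OF S(1)] S(3)])
      (simp_all add: M_intros M_sqrt_iter TM hermitian_diff sqrt_iter_hermitian T)
  moreover have "(\<lambda>n. Re (\<tau> (id_blinfun - sqrt_iter T' n))) \<longlonglongrightarrow> Re (\<tau> S')"
    by (rule \<tau>_LIMSEQ[OF _ _ SM(2) op_pos_hermitian[OF S'(1)] S'(3)])
      (simp_all add: M_intros M_sqrt_iter TM hermitian_diff sqrt_iter_hermitian T')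
  ultimately have "Re (\<tau> S') = Re (\<tau> S)" unfolding eq using LIMSEQ_unique by blast
  then show ?thesis using A by (simp add: norm_\<iota> M_adj SA SA')
qed

lemma norm_\<iota>_adj:
  assumes A: "A \<in> M"
  shows "norm (\<iota> (adj A)) = norm (\<iota> A)"
proof -
  define c where "c = norm A + 1"
  have c: "c > 0" by (simp add: c_def add_nonneg_pos)
  define B where "B = (1 / c) *\<^sub>R A"
  have B: "B \<in> M" unfolding B_def using A by (intro M_intros)
  have "norm B \<le> 1" using c by (simp add: B_def c_def)
  then have "norm (\<iota> (adj B)) = norm (\<iota> B)" using B by (intro norm_\<iota>_adj_contraction)
  then show ?thesis using c A by (simp add: B_def adj_scaleR M_BH \<iota>_scaleR M_adj)
qed

text \<open>Split \<open>A\<close> into \<open>H + \<i> *\<^sub>C J\<close> with hermitian parts; by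
  invariance of the norm under \<open>adj\<close>, each part has norm at most that of
  \<open>\<iota> A\<close>. The factor 2 counts the parts; any constant would do for extending
  \<open>\<tau>\<close>.\<close>

lemma cmod_\<tau>_le:
  assumes A: "A \<in> M"
  shows "cmod (\<tau> A) \<le> 2 * norm (\<iota> A)"
proof -
  have BH: "A \<in> BH" "adj A \<in> BH" using A by (simp_all add: M_BH)
  define H where "H = (1 / 2) *\<^sub>R (A + adj A)"
  define J where "J = (- \<i> / 2) *\<^sub>C (A - adj A)"
  have HM: "H \<in> M" "J \<in> M" unfolding H_def J_def by (intro M_intros A)+
  have hH: "hermitian H"
    unfolding H_def hermitian_def using BH by (simp add: adj_scaleR adj_add add.commute)
  have hJ: "hermitian J"
    unfolding J_def hermitian_def using BH
    by (simp add: adj_scaleC adj_diff scaleC_minus_left scaleC_diff_right)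
  have iJ: "\<i> *\<^sub>C J = (1 / 2) *\<^sub>R (A - adj A)"
    unfolding J_def scaleC_scaleC using scaleC_of_real[of "1 / 2" "A - adj A"] by simp
  have AHJ: "A = H + \<i> *\<^sub>C J"
    unfolding iJ H_def scaleR_add_right[symmetric] by simp
  have "norm (\<iota> H) \<le> norm (\<iota> A)"
  proof -
    have "norm (\<iota> H) = norm (\<iota> A + \<iota> (adj A)) / 2"
      unfolding H_def using A by (simp add: \<iota>_scaleR M_intros \<iota>_add)
    also have "\<dots> \<le> (norm (\<iota> A) + norm (\<iota> (adj A))) / 2" by (simp add: norm_triangle_ineq)
    finally show ?thesis by (simp add: norm_\<iota>_adj[OF A])
  qed
  moreover have "norm (\<iota> J) \<le> norm (\<iota> A)"
  proof -
    have "norm (\<iota> J) = norm (\<iota> A - \<iota> (adj A)) / 2"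
      unfolding J_def using A by (simp add: \<iota>_scaleC M_intros \<iota>_diff norm_scaleC norm_divide)
    also have "\<dots> \<le> (norm (\<iota> A) + norm (\<iota> (adj A))) / 2" by (simp add: norm_triangle_ineq4)
    finally show ?thesis by (simp add: norm_\<iota>_adj[OF A])
  qed
  moreover have "cmod (\<tau> A) \<le> cmod (\<tau> H) + cmod (\<tau> J)"
  proof -
    have "\<tau> A = \<tau> H + \<i> * \<tau> J"
      by (subst AHJ) (simp add: \<tau>_add \<tau>_scaleC HM M_intros)
    then show ?thesis using norm_triangle_ineq[of "\<tau> H" "\<i> * \<tau> J"] by (simp add: norm_mult)
  qed
  moreover have "cmod (\<tau> H) \<le> norm (\<iota> H)" "cmod (\<tau> J) \<le> norm (\<iota> J)"
    using \<tau>_hermitian[OF HM(1) hH] \<tau>_hermitian[OF HM(2) hJ] by (simp_all add: cmod_eq_Re)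
  ultimately show ?thesis by linarith
qed

section \<open>The quadratic form of the trace, and spectral truncation\<close>

text \<open>Cauchy-Schwarz for the trace form applied to the modulus and the identity, read off from
  nonnegativity of the trace of the square of \<open>B - t\<close>.\<close>

lemma norm_\<iota>_sq_le:
  assumes A: "A \<in> M"
  shows "(norm (\<iota> A))\<^sup>2 \<le> Re (\<tau> id_blinfun) * Re (\<tau> (adj A o\<^sub>L A))"
proof -
  define B where "B = op_abs A"
  have BM: "B \<in> M" and B: "op_pos B" and BB: "B o\<^sub>L B = adj A o\<^sub>L A"
    using A by (simp_all add: B_def M_op_abs op_abs_pos op_abs_square M_BH)
  have "0 \<le> Re (\<tau> (B o\<^sub>L B)) - 2 * t * Re (\<tau> B) + t\<^sup>2 * Re (\<tau> id_blinfun)" for t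
  proof -
    define C where "C = B - t *\<^sub>R id_blinfun"
    have C: "C \<in> M" "hermitian C" unfolding C_def
      by (intro M_intros BM) (intro hermitian_diff hermitian_scaleR hermitian_id op_pos_hermitian B)
    have "0 \<le> Re (\<tau> (C o\<^sub>L C))"
      using op_pos_adj_compose[OF M_BH[OF C(1)]] C \<tau>_pos[OF M_compose[OF C(1) C(1)]]
      by (simp add: hermitian_def)
    also have "C o\<^sub>L C = (B o\<^sub>L B) - t *\<^sub>R B - t *\<^sub>R B + t\<^sup>2 *\<^sub>R id_blinfun"
      unfolding C_def by (rule blinfun_eqI)
        (simp add: blinfun_apply_simps algebra_simps power2_eq_square)
    finally show ?thesis using BM by (simp add: \<tau>_add \<tau>_diff \<tau>_scaleR M_intros)
  qed
  then have "(Re (\<tau> B))\<^sup>2 \<le> Re (\<tau> id_blinfun) * Re (\<tau> (B o\<^sub>L B))"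
    using \<tau>_pos[OF M_id op_pos_id] by (intro quadratic_discriminant_nonneg) auto
  then show ?thesis unfolding norm_\<iota>[OF A] B_def[symmetric] BB .
qed

lemma \<tau>_square_nonneg: "A \<in> M \<Longrightarrow> 0 \<le> Re (\<tau> (adj A o\<^sub>L A))"
  using \<tau>_pos[of "adj A o\<^sub>L A"] by (simp add: M_intros op_pos_adj_compose M_BH)

text \<open>The parallelogram law for the sesquilinear form of the trace, in the shape required by
  \<open>q_conv\<close>; it follows by expanding both sides.\<close>

lemma \<tau>_square_convex_combination:
  assumes u: "u \<in> M" and v: "v \<in> M"
  shows "Re (\<tau> (adj ((1 - t) *\<^sub>R u + t *\<^sub>R v) o\<^sub>L ((1 - t) *\<^sub>R u + t *\<^sub>R v)))
    = (1 - t) * Re (\<tau> (adj u o\<^sub>L u)) + t * Re (\<tau> (adj v o\<^sub>L v))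
      - t * (1 - t) * Re (\<tau> (adj (u - v) o\<^sub>L (u - v)))"
proof -
  have BH: "u \<in> BH" "v \<in> BH" using u v by (simp_all add: M_BH)
  have M4: "adj u o\<^sub>L u \<in> M" "adj u o\<^sub>L v \<in> M" "adj v o\<^sub>L u \<in> M" "adj v o\<^sub>L v \<in> M"
    using u v by (simp_all add: M_intros)
  show ?thesis
    using BH M4 by (simp add: adj_add adj_diff adj_scaleR blinfun_compose_simps \<tau>_add \<tau>_diff \<tau>_scaleR M_intros)
      (simp add: algebra_simps)
qed

text \<open>\<open>p\<close> is the average of the identity and the symmetry
  \<open>u = 2 p - 1\<close>. Since \<open>u\<close> is a self-adjoint unitary, left multiplication
  by it preserves the modulus and hence the norm.\<close>

lemma norm_\<iota>_projection_compose:
  assumes p: "p \<in> projections M" and A: "A \<in> M"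
  shows "norm (\<iota> (p o\<^sub>L A)) \<le> norm (\<iota> A)"
proof -
  have pM: "p \<in> M" "adj p = p" and pp: "p o\<^sub>L p = p" using p by (auto simp: projections_def)
  define u where "u = 2 *\<^sub>R p - id_blinfun"
  have u: "u \<in> M" unfolding u_def using pM by (intro M_intros)
  have au: "adj u = u" unfolding u_def using pM by (simp add: adj_diff adj_scaleR M_BH)
  have "p (p x) = p x" for x using pp by (metis blinfun_apply_blinfun_compose)
  then have uu: "u o\<^sub>L u = id_blinfun"
    unfolding u_def by (intro blinfun_eqI) (simp add: blinfun_apply_simps scaleR_2)
  have "adj (u o\<^sub>L A) o\<^sub>L (u o\<^sub>L A) = adj A o\<^sub>L ((u o\<^sub>L u) o\<^sub>L A)"
    using A u by (simp add: adj_compose M_BH au blinfun_compose_assoc)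
  also have "\<dots> = adj A o\<^sub>L A" by (simp add: uu)
  finally have "op_abs (u o\<^sub>L A) = op_abs A" by (simp add: op_abs_def)
  then have nu: "norm (\<iota> (u o\<^sub>L A)) = norm (\<iota> A)" using A u by (simp add: norm_\<iota> M_intros)
  have "p o\<^sub>L A = (1 / 2) *\<^sub>R (A + (u o\<^sub>L A))"
    unfolding u_def by (intro blinfun_eqI) (simp add: blinfun_apply_simps scaleR_2)
  then have "norm (\<iota> (p o\<^sub>L A)) = norm (\<iota> A + \<iota> (u o\<^sub>L A)) / 2"
    using A u by (simp add: \<iota>_scaleR \<iota>_add M_intros)
  also have "\<dots> \<le> (norm (\<iota> A) + norm (\<iota> (u o\<^sub>L A))) / 2" by (simp add: norm_triangle_ineq)
  finally show ?thesis by (simp add: nu)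
qed

text \<open>\<open>p\<close> is the spectral projection of \<open>x\<close> for
  \<open>(K, \<infinity>)\<close>. The chain \<open>K p \<le> p x \<le> x\<close> bounds its trace,
  and the remainder lies between 0 and \<open>K\<close>.\<close>

lemma truncation:
  assumes x: "x \<in> M" "op_pos x" and K: "K \<ge> 0"
  obtains p where "p \<in> projections M" "K * Re (\<tau> p) \<le> Re (\<tau> x)"
    "norm (\<iota> (p o\<^sub>L x)) = Re (\<tau> (p o\<^sub>L x))"
    "Re (\<tau> (adj (x - (p o\<^sub>L x)) o\<^sub>L (x - (p o\<^sub>L x)))) \<le> K\<^sup>2 * Re (\<tau> id_blinfun)"
proof -
  obtain e where eM: "e \<in> M" and e: "hermitian e" "e o\<^sub>L e = e" "e o\<^sub>L x = x o\<^sub>L e"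
    and low: "\<And>\<xi>. Re (cinner (blinfun_apply e \<xi>) (blinfun_apply x (blinfun_apply e \<xi>)))
      \<le> K * (norm (blinfun_apply e \<xi>))\<^sup>2"
    and high: "\<And>\<xi>. K * (norm (\<xi> - blinfun_apply e \<xi>))\<^sup>2
      \<le> Re (cinner (\<xi> - blinfun_apply e \<xi>) (blinfun_apply x (\<xi> - blinfun_apply e \<xi>)))"
    by (rule spectral_cut_in_M[OF op_pos_hermitian[OF x(2)] x(1), of K]) (rule that)
  have ee: "e (e \<xi>) = e \<xi>" for \<xi> using e(2) by (metis blinfun_apply_blinfun_compose)
  have ex: "e (x \<xi>) = x (e \<xi>)" for \<xi> using e(3) by (metis blinfun_apply_blinfun_compose)
  define p where "p = id_blinfun - e"
  have pM: "p \<in> M" unfolding p_def using eM by (intro M_intros)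
  have hp: "hermitian p" unfolding p_def using e(1) by (simp add: hermitian_diff)
  have ap: "adj p = p" and ae: "adj e = e" using hp e(1) by (simp_all add: hermitian_def)
  have px: "p \<xi> = \<xi> - e \<xi>" for \<xi> by (simp add: p_def blinfun_apply_simps)
  have pp: "p o\<^sub>L p = p" by (intro blinfun_eqI) (simp add: px blinfun_apply_simps ee)
  have p: "p \<in> projections M" using pM ap pp by (simp add: projections_def)
  \<comment> \<open>Since \<open>p\<close> and \<open>e\<close> are idempotent and commute with
    \<open>x\<close>, both pieces are compressions \<open>p x p\<close> and \<open>e x e\<close>,
    hence positive.\<close>
  have pxp: "p o\<^sub>L x = adj p o\<^sub>L x o\<^sub>L p" unfolding ap
    by (intro blinfun_eqI) (simp add: px blinfun_apply_simps ee ex)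
  have exe: "x - (p o\<^sub>L x) = adj e o\<^sub>L x o\<^sub>L e" unfolding ae
    by (intro blinfun_eqI) (simp add: px blinfun_apply_simps ee ex)
  have Ppx: "op_pos (p o\<^sub>L x)" unfolding pxp by (rule op_pos_sandwich[OF x(2) M_BH[OF pM]])
  have Pex: "op_pos (x - (p o\<^sub>L x))" unfolding exe by (rule op_pos_sandwich[OF x(2) M_BH[OF eM]])
  have pxM: "p o\<^sub>L x \<in> M" using pM x by (intro M_intros)
  have "op_pos ((p o\<^sub>L x) - K *\<^sub>R p)"
  proof (rule op_posI)
    show "hermitian ((p o\<^sub>L x) - K *\<^sub>R p)"
      using Ppx hp by (simp add: hermitian_diff hermitian_scaleR op_pos_hermitian)
    fix \<xi>
    have "p (p \<xi>) = p \<xi>" by (simp add: px blinfun_apply_simps ee)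
    then have "cinner \<xi> (p \<xi>) = cinner (p \<xi>) (p \<xi>)"
      using hermitian_cinner[OF hp, of \<xi> "p \<xi>"] by simp
    moreover have "(p o\<^sub>L x) \<xi> = p (x (p \<xi>))"
      by (simp add: px blinfun_apply_simps ee ex)
    then have "cinner \<xi> ((p o\<^sub>L x) \<xi>) = cinner (p \<xi>) (x (p \<xi>))"
      using hermitian_cinner[OF hp, of \<xi>] by simp
    ultimately have "Re (cinner \<xi> (((p o\<^sub>L x) - K *\<^sub>R p) \<xi>))
        = Re (cinner (p \<xi>) (x (p \<xi>))) - K * (norm (p \<xi>))\<^sup>2"
      by (simp add: blinfun.diff_left blinfun.scaleR_left cinner_simps power2_norm_cinner)
    then show "0 \<le> Re (cinner \<xi> (((p o\<^sub>L x) - K *\<^sub>R p) \<xi>))"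
      using high[of \<xi>] by (simp add: px)
  qed
  then have "Re (\<tau> (K *\<^sub>R p)) \<le> Re (\<tau> (p o\<^sub>L x))" using pM pxM x by (intro \<tau>_mono M_intros)
  moreover have "Re (\<tau> (p o\<^sub>L x)) \<le> Re (\<tau> x)" by (rule \<tau>_mono[OF pxM x(1) Pex])
  ultimately have Kp: "K * Re (\<tau> p) \<le> Re (\<tau> x)" using pM by (simp add: \<tau>_scaleR)
  have e_le: "(norm (e \<xi>))\<^sup>2 \<le> (norm \<xi>)\<^sup>2" for \<xi>
  proof -
    have "op_pos p" using op_pos_sandwich[OF op_pos_id M_BH[OF pM]] by (simp add: ap pp)
    then have "0 \<le> Re (cinner \<xi> (p \<xi>))" by (rule op_pos_Re)
    moreover have "cinner \<xi> (e \<xi>) = cinner (e \<xi>) (e \<xi>)"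
      using hermitian_cinner[OF e(1), of \<xi> "e \<xi>"] ee by simp
    ultimately show ?thesis by (simp add: px cinner_simps power2_norm_cinner)
  qed
  let ?u = "x - (p o\<^sub>L x)"
  have uM: "?u \<in> M" by (rule M_diff[OF x(1) pxM])
  have "norm ?u \<le> K"
  proof (rule op_pos_norm_le[OF Pex K], rule op_posI)
    show "hermitian (K *\<^sub>R id_blinfun - ?u)"
      by (intro hermitian_diff hermitian_scaleR hermitian_id op_pos_hermitian[OF Pex])
    fix \<xi>
    have "cinner \<xi> (?u \<xi>) = cinner (e \<xi>) (x (e \<xi>))"
      unfolding exe ae using hermitian_cinner[OF e(1), of \<xi>] by simp
    moreover have "K * (norm (e \<xi>))\<^sup>2 \<le> K * (norm \<xi>)\<^sup>2" using e_le K by (intro mult_left_mono)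
    ultimately show "0 \<le> Re (cinner \<xi> ((K *\<^sub>R id_blinfun - ?u) \<xi>))"
      using low[of \<xi>] unfolding blinfun.diff_left[of _ ?u] cinner_diff_right
      by (simp add: blinfun.scaleR_left cinner_simps cinner_self)
  qed
  then have "op_pos (K\<^sup>2 *\<^sub>R id_blinfun - (adj ?u o\<^sub>L ?u))"
    by (rule op_pos_minus_adj_compose[OF M_BH[OF uM]])
  then have "Re (\<tau> (adj ?u o\<^sub>L ?u)) \<le> Re (\<tau> (K\<^sup>2 *\<^sub>R id_blinfun))"
    by (rule \<tau>_mono[OF M_compose[OF M_adj[OF uM] uM] M_scaleR[OF M_id]])
  then have "Re (\<tau> (adj ?u o\<^sub>L ?u)) \<le> K\<^sup>2 * Re (\<tau> id_blinfun)"
    by (simp add: \<tau>_scaleR M_id)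
  with p Kp norm_\<iota>_pos[OF pxM Ppx] show ?thesis by (rule that)
qed

end

section \<open>Smoothing and fixed points\<close>

context tracial_L1
begin

section \<open>Continuous extension from \<open>M\<close> to \<open>L\<^sup>1\<close>\<close>

lemma L1_dense:
  obtains X where "\<And>n. X n \<in> M" "(\<lambda>n. \<iota> (X n)) \<longlonglongrightarrow> z"
proof -
  have "z \<in> closure (\<iota> ` M)" using compl by (simp add: L1_completion_def)
  then obtain Y where Y: "\<And>n. Y n \<in> \<iota> ` M" "Y \<longlonglongrightarrow> z" unfolding closure_sequential by blast
  then have "\<forall>n. \<exists>x\<in>M. Y n = \<iota> x" by blast
  then obtain X where "\<And>n. X n \<in> M" "\<And>n. Y n = \<iota> (X n)" by metis
  moreover from this have "Y = (\<lambda>n. \<iota> (X n))" by blast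
  ultimately show ?thesis using that Y(2) by blast
qed

text \<open>A Lipschitz map has a limit along the filter defining \<open>L1_extend\<close>, so that
  \<open>Lim\<close> denotes a genuine value. The estimate is the form in which the extension is
  used throughout.\<close>

lemma L1_extend_diff_le:
  fixes f :: "('h \<Rightarrow>\<^sub>L 'h) \<Rightarrow> 'c::banach"
  assumes f_diff: "\<And>A B. A \<in> M \<Longrightarrow> B \<in> M \<Longrightarrow> f (A - B) = f A - f B"
    and f_le: "\<And>A. A \<in> M \<Longrightarrow> norm (f A) \<le> C * norm (\<iota> A)"
    and A: "A \<in> M"
  shows "norm (f A - L1_extend M \<iota> f z) \<le> C * norm (\<iota> A - z)"
proof -
  have lip: "norm (f A - f B) \<le> C * norm (\<iota> A - \<iota> B)" if "A \<in> M" "B \<in> M" for A B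
    using f_le[OF M_diff[OF that]] f_diff[OF that] \<iota>_diff[OF that] by simp
  obtain X where X: "\<And>n. X n \<in> M" and lim: "(\<lambda>n. \<iota> (X n)) \<longlonglongrightarrow> z" by (rule L1_dense) (rule that)
  \<comment> \<open>\<open>C\<close> may be 0 or negative; a positive constant is needed to divide
    by.\<close>
  define C' where "C' = \<bar>C\<bar> + 1"
  have C': "C' > 0" "C * norm w \<le> C' * norm w" for w :: 'l
    by (auto simp: C'_def intro!: mult_right_mono)
  have "Cauchy (\<lambda>n. f (X n))"
  proof (rule CauchyI)
    fix e :: real assume e: "e > 0"
    obtain N where N: "\<And>m n. m \<ge> N \<Longrightarrow> n \<ge> N \<Longrightarrow> norm (\<iota> (X m) - \<iota> (X n)) < e / C'"
      using CauchyD[OF LIMSEQ_imp_Cauchy[OF lim], of "e / C'"] e C'(1) by (metis divide_pos_pos)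
    have "norm (f (X m) - f (X n)) < e" if "m \<ge> N" "n \<ge> N" for m n
    proof -
      have "norm (f (X m) - f (X n)) \<le> C' * norm (\<iota> (X m) - \<iota> (X n))"
        using order_trans[OF lip[OF X X] C'(2)] .
      also have "\<dots> < C' * (e / C')" using N[OF that] C'(1) by (intro mult_strict_left_mono)
      finally show ?thesis using C'(1) by simp
    qed
    then show "\<exists>N. \<forall>m\<ge>N. \<forall>n\<ge>N. norm (f (X m) - f (X n)) < e" by blast
  qed
  then obtain L where L: "(\<lambda>n. f (X n)) \<longlonglongrightarrow> L" using Cauchy_convergent convergent_def by blast
  have le: "norm (f B - L) \<le> C * norm (\<iota> B - z)" if B: "B \<in> M" for B
  proof (rule LIMSEQ_le)
    show "(\<lambda>n. norm (f B - f (X n))) \<longlonglongrightarrow> norm (f B - L)" by (intro tendsto_intros L)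
    show "(\<lambda>n. C * norm (\<iota> B - \<iota> (X n))) \<longlonglongrightarrow> C * norm (\<iota> B - z)" by (intro tendsto_intros lim)
    show "\<exists>N. \<forall>n\<ge>N. norm (f B - f (X n)) \<le> C * norm (\<iota> B - \<iota> (X n))" using lip[OF B X] by blast
  qed
  let ?F = "inf (filtercomap \<iota> (nhds z)) (principal M)"
  have ev: "eventually P ?F \<longleftrightarrow> (\<exists>Q. eventually Q (nhds z) \<and> (\<forall>x. Q (\<iota> x) \<longrightarrow> x \<in> M \<longrightarrow> P x))" for P
    by (simp add: eventually_inf_principal eventually_filtercomap)
  \<comment> \<open>Density of the image of \<open>M\<close> makes the filter proper, without which
    the limit would not be unique.\<close>
  have nt: "?F \<noteq> bot"
  proof
    assume "?F = bot"
    then have "eventually (\<lambda>_. False) ?F" by simp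
    then obtain Q where Q: "eventually Q (nhds z)" "\<And>x. Q (\<iota> x) \<Longrightarrow> x \<notin> M" unfolding ev by blast
    have "\<forall>\<^sub>F n in sequentially. Q (\<iota> (X n))"
      using lim Q(1) by (simp add: filterlim_iff)
    then obtain n where "Q (\<iota> (X n))" by (auto simp: eventually_sequentially)
    then show False using Q(2) X by blast
  qed
  have "(f \<longlongrightarrow> L) ?F"
  proof (rule tendstoI)
    fix e :: real assume e: "e > 0"
    have "dist (f B) L < e" if "B \<in> M" "dist (\<iota> B) z < e / C'" for B
    proof -
      have "norm (f B - L) \<le> C' * norm (\<iota> B - z)" by (rule order_trans[OF le[OF that(1)] C'(2)])
      also have "\<dots> < C' * (e / C')"
        using that(2) C'(1) by (intro mult_strict_left_mono) (simp_all add: dist_norm)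
      finally show ?thesis using C'(1) by (simp add: dist_norm)
    qed
    moreover have "eventually (\<lambda>w. dist w z < e / C') (nhds z)"
      using e C'(1) unfolding eventually_nhds_metric by (intro exI[of _ "e / C'"]) simp
    ultimately show "\<forall>\<^sub>F x in ?F. dist (f x) L < e" unfolding ev by blast
  qed
  then have "L1_extend M \<iota> f z = L"
    unfolding L1_extend_def using nt by (intro tendsto_Lim)
  then show ?thesis using le[OF A] by simp
qed

text \<open>Two extensions are composed: left multiplication by \<open>p\<close> contributes the
  constant 1 and the trace the constant 2. This transfers the smoothing bound from an iterate to a
  nearby element of \<open>M\<close>.\<close>

lemma \<tau>_diff_L1_trace_lmult_le:
  assumes p: "p \<in> projections M" and x: "x \<in> M"
  shows "cmod (\<tau> (p o\<^sub>L x) - L1_trace M \<tau> \<iota> (L1_lmult M \<iota> p y)) \<le> 2 * norm (\<iota> x - y)"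
proof -
  have pM: "p \<in> M" using p by (simp add: projections_def)
  have px: "p o\<^sub>L x \<in> M" using pM x by (rule M_compose)
  have "norm (\<tau> (p o\<^sub>L x) - L1_trace M \<tau> \<iota> (L1_lmult M \<iota> p y))
      \<le> 2 * norm (\<iota> (p o\<^sub>L x) - L1_lmult M \<iota> p y)"
    unfolding L1_trace_def by (rule L1_extend_diff_le[OF \<tau>_diff cmod_\<tau>_le px])
  moreover have "norm (\<iota> (p o\<^sub>L x) - L1_lmult M \<iota> p y) \<le> 1 * norm (\<iota> x - y)"
    unfolding L1_lmult_def
  proof (rule L1_extend_diff_le[OF _ _ x])
    show "\<iota> (p o\<^sub>L (A - B)) = \<iota> (p o\<^sub>L A) - \<iota> (p o\<^sub>L B)" if "A \<in> M" "B \<in> M" for A B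
      using that pM by (simp add: blinfun_compose_diff \<iota>_diff M_compose)
    show "norm (\<iota> (p o\<^sub>L A)) \<le> 1 * norm (\<iota> A)" if "A \<in> M" for A
      using norm_\<iota>_projection_compose[OF p that] by simp
  qed
  ultimately show ?thesis by simp
qed

section \<open>The positive cone of \<open>L\<^sup>1\<close>\<close>

lemma L1_pos_sequence:
  assumes "a \<in> L1_pos M \<iota>"
  obtains X where "\<And>n. X n \<in> M" "\<And>n. op_pos (X n)" "(\<lambda>n. \<iota> (X n)) \<longlonglongrightarrow> a"
proof -
  obtain Y where Y: "\<And>n. Y n \<in> \<iota> ` positives M" "Y \<longlonglongrightarrow> a"
    using assms unfolding L1_pos_def closure_sequential by blast
  then have "\<forall>n. \<exists>x\<in>positives M. Y n = \<iota> x" by blast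
  then obtain X where X: "\<And>n. X n \<in> positives M" "\<And>n. Y n = \<iota> (X n)" by metis
  then have "Y = (\<lambda>n. \<iota> (X n))" by blast
  then show ?thesis using that[of X] X Y(2) by (simp add: positives_def)
qed

lemma L1_pos_limit:
  assumes "\<And>n. X n \<in> M" "\<And>n. op_pos (X n)" "(\<lambda>n. \<iota> (X n)) \<longlonglongrightarrow> a"
  shows "a \<in> L1_pos M \<iota>"
  unfolding L1_pos_def closure_sequential
  by (rule exI[of _ "\<lambda>n. \<iota> (X n)"]) (use assms in \<open>simp add: positives_def\<close>)

text \<open>On positive elements of \<open>M\<close> the norm is the trace, which is additive; both
  claims pass to limits.\<close>

lemma L1_pos_add:
  assumes "a \<in> L1_pos M \<iota>" "b \<in> L1_pos M \<iota>"
  shows "a + b \<in> L1_pos M \<iota>" "norm (a + b) = norm a + norm b"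
proof -
  obtain X where X: "\<And>n. X n \<in> M" "\<And>n. op_pos (X n)" "(\<lambda>n. \<iota> (X n)) \<longlonglongrightarrow> a"
    using assms(1) by (rule L1_pos_sequence) (rule that)
  obtain Y where Y: "\<And>n. Y n \<in> M" "\<And>n. op_pos (Y n)" "(\<lambda>n. \<iota> (Y n)) \<longlonglongrightarrow> b"
    using assms(2) by (rule L1_pos_sequence) (rule that)
  have XY: "X n + Y n \<in> M" "op_pos (X n + Y n)" for n using X Y by (simp_all add: M_add op_pos_add)
  have lim: "(\<lambda>n. \<iota> (X n + Y n)) \<longlonglongrightarrow> a + b"
    using tendsto_add[OF X(3) Y(3)] X Y by (simp add: \<iota>_add)
  show "a + b \<in> L1_pos M \<iota>" by (rule L1_pos_limit[OF XY lim])
  have "norm (\<iota> (X n + Y n)) = norm (\<iota> (X n)) + norm (\<iota> (Y n))" for n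
    using X Y XY by (simp add: norm_\<iota>_pos \<tau>_add)
  then show "norm (a + b) = norm a + norm b"
    using tendsto_norm[OF lim] tendsto_add[OF tendsto_norm[OF X(3)] tendsto_norm[OF Y(3)]]
    by (simp add: LIMSEQ_unique)
qed

lemma L1_pos_scaleR:
  assumes "a \<in> L1_pos M \<iota>" "0 \<le> r"
  shows "r *\<^sub>R a \<in> L1_pos M \<iota>"
proof -
  obtain X where X: "\<And>n. X n \<in> M" "\<And>n. op_pos (X n)" "(\<lambda>n. \<iota> (X n)) \<longlonglongrightarrow> a"
    using assms(1) by (rule L1_pos_sequence) (rule that)
  have "r *\<^sub>R X n \<in> M" "op_pos (r *\<^sub>R X n)" for n
    using X assms(2) by (simp_all add: M_scaleR op_pos_scaleR)
  moreover have "(\<lambda>n. \<iota> (r *\<^sub>R X n)) \<longlonglongrightarrow> r *\<^sub>R a"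
    using tendsto_scaleR[OF tendsto_const X(3)] X by (simp add: \<iota>_scaleR)
  ultimately show ?thesis by (rule L1_pos_limit)
qed

text \<open>A lower bound on the norm is not a convex condition in general; additivity on the cone
  makes it one. It keeps convex combinations of the orbit away from 0.\<close>

lemma convex_L1_pos_norm_ge: "convex {a \<in> L1_pos M \<iota>. c \<le> norm a}"
  unfolding convex_alt
proof (intro ballI allI impI CollectI conjI)
  fix a b and t :: real
  assume ab: "a \<in> {a \<in> L1_pos M \<iota>. c \<le> norm a}" "b \<in> {a \<in> L1_pos M \<iota>. c \<le> norm a}"
    and t: "0 \<le> t \<and> t \<le> 1"
  have P: "(1 - t) *\<^sub>R a \<in> L1_pos M \<iota>" "t *\<^sub>R b \<in> L1_pos M \<iota>"
    using ab t by (auto intro!: L1_pos_scaleR)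
  show "(1 - t) *\<^sub>R a + t *\<^sub>R b \<in> L1_pos M \<iota>" by (rule L1_pos_add(1)[OF P])
  have "c = (1 - t) * c + t * c" by (simp add: algebra_simps)
  also have "\<dots> \<le> (1 - t) * norm a + t * norm b"
    using ab t by (intro add_mono mult_left_mono) auto
  also have "\<dots> = norm ((1 - t) *\<^sub>R a + t *\<^sub>R b)"
    unfolding L1_pos_add(2)[OF P] using t by simp
  finally show "c \<le> norm ((1 - t) *\<^sub>R a + t *\<^sub>R b)" .
qed

lemma L1_pos_subset_L1_sa: "L1_pos M \<iota> \<subseteq> L1_sa M \<iota>"
  unfolding L1_pos_def L1_sa_def
proof (rule closure_mono, rule image_mono, rule subsetI)
  fix A assume "A \<in> positives M"
  then show "A \<in> self_adjoints M"
    using op_pos_hermitian[of A] by (auto simp: positives_def self_adjoints_def hermitian_def)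
qed

text \<open>An \<open>L\<^sup>1\<close> bound makes the spectral projection of an approximant for \<open>(K, \<infinity>)\<close> small in trace
  for large \<open>K\<close>, and smoothing then makes the part cut off small in norm.\<close>

lemma smoothing_approximable:
  assumes smooth: "smoothing M \<tau> \<iota> T y" and pos: "\<And>n. (T ^^ n) y \<in> L1_pos M \<iota>"
    and bound: "\<And>n. norm ((T ^^ n) y) \<le> R" and e: "\<epsilon> > 0"
  shows "\<exists>B n0. \<forall>n\<ge>n0. \<exists>u\<in>M. norm ((T ^^ n) y - \<iota> u) \<le> \<epsilon> \<and> Re (\<tau> (adj u o\<^sub>L u)) \<le> B"
proof -
  obtain \<delta> n0 where \<delta>: "\<delta> > 0"
    and sm: "\<And>p n. p \<in> projections M \<Longrightarrow> Re (\<tau> p) < \<delta> \<Longrightarrow> n \<ge> n0 \<Longrightarrow>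
      Re (L1_trace M \<tau> \<iota> (L1_lmult M \<iota> p ((T ^^ n) y))) < \<epsilon> / 4"
    using smooth[unfolded smoothing_def] e by (metis divide_pos_pos zero_less_numeral)
  \<comment> \<open>Chosen so that \<open>K * \<delta>\<close> exceeds the trace of every
    approximant below; the truncation projection then has trace less than
    \<open>\<delta>\<close>.\<close>
  define K where "K = (\<bar>R\<bar> + \<epsilon> + 1) / \<delta>"
  have K: "K > 0" using \<delta> e by (simp add: K_def)
  have "\<exists>u\<in>M. norm ((T ^^ n) y - \<iota> u) \<le> \<epsilon> \<and> Re (\<tau> (adj u o\<^sub>L u)) \<le> K\<^sup>2 * Re (\<tau> id_blinfun)"
    if n: "n \<ge> n0" for n
  proof -
    let ?y = "(T ^^ n) y"
    \<comment> \<open>Error budget: smoothing gives \<open>\<epsilon> / 4\<close> and the transfer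
      to \<open>x\<close> costs \<open>2 * \<epsilon> / 8\<close>, so the part cut off has norm at
      most \<open>\<epsilon> / 2\<close>; approximation of the iterate by \<open>x\<close> adds
      \<open>\<epsilon> / 8\<close>.\<close>
    obtain x where x: "x \<in> M" "op_pos x" and xy: "norm (\<iota> x - ?y) < \<epsilon> / 8"
    proof -
      obtain X where X: "\<And>n. X n \<in> M" "\<And>n. op_pos (X n)" "(\<lambda>n. \<iota> (X n)) \<longlonglongrightarrow> ?y"
        using pos[of n] by (rule L1_pos_sequence) (rule that)
      obtain k where "norm (\<iota> (X k) - ?y) < \<epsilon> / 8"
        using LIMSEQ_D[OF X(3), of "\<epsilon> / 8"] e by auto
      then show ?thesis using that X by blast
    qed
    obtain p where p: "p \<in> projections M" and Kp: "K * Re (\<tau> p) \<le> Re (\<tau> x)"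
      and npx: "norm (\<iota> (p o\<^sub>L x)) = Re (\<tau> (p o\<^sub>L x))"
      and qu: "Re (\<tau> (adj (x - (p o\<^sub>L x)) o\<^sub>L (x - (p o\<^sub>L x)))) \<le> K\<^sup>2 * Re (\<tau> id_blinfun)"
      by (rule truncation[OF x, of K]) (use K that in \<open>simp_all\<close>)
    have pM: "p \<in> M" using p by (simp add: projections_def)
    have px: "p o\<^sub>L x \<in> M" using pM x(1) by (rule M_compose)
    have "Re (\<tau> x) = norm (\<iota> x)" using x by (simp add: norm_\<iota>_pos)
    also have "\<dots> \<le> norm ?y + norm (\<iota> x - ?y)" by (metis norm_triangle_sub)
    also have "\<dots> < \<bar>R\<bar> + \<epsilon> + 1" using bound[of n] xy e by linarith
    also have "\<dots> = K * \<delta>" using \<delta> by (simp add: K_def)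
    finally have "K * Re (\<tau> p) < K * \<delta>" using Kp by linarith
    then have "Re (\<tau> p) < \<delta>" using K by simp
    then have "Re (L1_trace M \<tau> \<iota> (L1_lmult M \<iota> p ?y)) < \<epsilon> / 4" by (rule sm[OF p _ n])
    moreover have "Re (\<tau> (p o\<^sub>L x)) - Re (L1_trace M \<tau> \<iota> (L1_lmult M \<iota> p ?y)) \<le> 2 * norm (\<iota> x - ?y)"
      using order_trans[OF complex_Re_le_cmod \<tau>_diff_L1_trace_lmult_le[OF p x(1), of ?y]] by simp
    ultimately have "norm (\<iota> (p o\<^sub>L x)) \<le> \<epsilon> / 2" unfolding npx using xy by linarith
    moreover have "?y - \<iota> (x - (p o\<^sub>L x)) = \<iota> (p o\<^sub>L x) - (\<iota> x - ?y)"
      using x(1) px by (simp add: \<iota>_diff)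
    then have "norm (?y - \<iota> (x - (p o\<^sub>L x))) \<le> norm (\<iota> (p o\<^sub>L x)) + norm (\<iota> x - ?y)"
      using norm_triangle_ineq4[of "\<iota> (p o\<^sub>L x)" "\<iota> x - ?y"] by metis
    ultimately have "norm (?y - \<iota> (x - (p o\<^sub>L x))) \<le> \<epsilon>" using xy e by linarith
    then show ?thesis using qu M_diff[OF x(1) px] by blast
  qed
  then show ?thesis by blast
qed

end

text \<open>For the average of \<open>N\<close> consecutive iterates starting at \<open>k\<close>,
  the difference \<open>T a - a\<close> telescopes to two boundary terms divided by
  \<open>N\<close>.\<close>

lemma cesaro_almost_invariant:
  fixes T :: "'a::real_normed_vector \<Rightarrow> 'a"
  assumes T: "linear T" and bound: "\<And>n. norm ((T ^^ n) y) \<le> R" and e: "\<epsilon> > 0"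
  shows "\<exists>a \<in> convex hull {(T ^^ j) y |j. j \<ge> k}. norm (T a - a) \<le> \<epsilon>"
proof -
  obtain N where N: "2 * \<bar>R\<bar> / \<epsilon> < real N" using reals_Archimedean2 by blast
  have N0: "real N > 0" using N e by (smt (verit) divide_nonneg_pos)
  define s where "s = (\<Sum>i<N. (T ^^ (k + i)) y)"
  define a where "a = (1 / real N) *\<^sub>R s"
  have "a = (\<Sum>i\<in>{..<N}. (1 / real N) *\<^sub>R (T ^^ (k + i)) y)"
    by (simp add: a_def s_def scaleR_sum_right)
  also have "\<dots> \<in> convex hull {(T ^^ j) y |j. j \<ge> k}"
    by (rule convex_sum) (use N0 in \<open>auto intro!: hull_inc\<close>)
  finally have "a \<in> convex hull {(T ^^ j) y |j. j \<ge> k}" .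
  moreover have "T s = (\<Sum>i<N. (T ^^ (k + Suc i)) y)"
    by (simp add: s_def linear_sum[OF T])
  then have "T s - s = (T ^^ (k + N)) y - (T ^^ k) y"
    using sum_lessThan_telescope[of "\<lambda>i. (T ^^ (k + i)) y" N] by (simp add: s_def sum_subtractf)
  then have "norm (T s - s) \<le> norm ((T ^^ (k + N)) y) + norm ((T ^^ k) y)"
    using norm_triangle_ineq4 by metis
  then have "norm (T s - s) \<le> 2 * \<bar>R\<bar>" using bound[of "k + N"] bound[of k] by linarith
  then have "norm (T s - s) / real N \<le> \<epsilon>" using N N0 e by (simp add: field_simps)
  moreover have "T a - a = (1 / real N) *\<^sub>R (T s - s)"
    by (simp add: a_def linear_scale[OF T] scaleR_diff_right)
  ultimately show ?thesis by (intro bexI[of _ a]) simp_all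
qed

theorem theorem3p1:
  fixes M :: "('h::complex_hilbert_space \<Rightarrow>\<^sub>L 'h) set"
    and \<tau> :: "('h \<Rightarrow>\<^sub>L 'h) \<Rightarrow> complex"
    and \<iota> :: "('h \<Rightarrow>\<^sub>L 'h) \<Rightarrow> 'l::complex_banach"
    and T :: "'l \<Rightarrow> 'l"
    and y :: 'l
  assumes "von_neumann_algebra M"
    and "finite_trace M \<tau>" and "faithful_trace M \<tau>" and "normal_trace M \<tau>"
    and "L1_completion M \<tau> \<iota>"
    and "positive_contraction M \<iota> T"
    and "y \<in> L1_pos M \<iota>"
    and "smoothing M \<tau> \<iota> T y"
  shows "((\<lambda>n. norm ((T ^^ n) y)) \<longlonglongrightarrow> 0) \<or>
    (\<exists>z. z \<in> L1_pos M \<iota> \<and> z \<noteq> 0 \<and> T z = z)"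
proof (rule disj_imp[THEN iffD2], rule impI)
  assume not0: "\<not> ((\<lambda>n. norm ((T ^^ n) y)) \<longlonglongrightarrow> 0)"
  interpret tracial_L1 M \<tau> \<iota> using assms by unfold_locales
  have blT: "bounded_linear T" and Tpos: "\<And>x. x \<in> L1_pos M \<iota> \<Longrightarrow> T x \<in> L1_pos M \<iota>"
    and Tcontr: "\<And>x. x \<in> L1_sa M \<iota> \<Longrightarrow> norm (T x) \<le> norm x"
    using assms(6) by (auto simp: positive_contraction_def bounded_clinear_def)
  have pos: "(T ^^ n) y \<in> L1_pos M \<iota>" for n
    by (induction n) (simp_all add: assms(7) Tpos)
  \<comment> \<open>Contractivity is available on \<open>L1_sa\<close>, and the orbit stays in the
    positive cone, which lies inside it.\<close>
  have dec: "decseq (\<lambda>n. norm ((T ^^ n) y))"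
    by (rule decseq_SucI) (use pos Tcontr L1_pos_subset_L1_sa in auto)
  obtain c where c: "(\<lambda>n. norm ((T ^^ n) y)) \<longlonglongrightarrow> c" "\<And>n. c \<le> norm ((T ^^ n) y)"
    using decseq_convergent[OF dec, of 0] by auto
  have "0 \<le> c" using LIMSEQ_le_const[OF c(1)] by auto
  then have c0: "c > 0" using c(1) not0 by (cases "c = 0") auto
  have bound: "norm ((T ^^ n) y) \<le> norm y" for n using decseqD[OF dec, of 0 n] by simp
  define C where "C k = convex hull {(T ^^ j) y |j. j \<ge> k} \<inter> {a. norm (T a - a) \<le> 1 / real (Suc k)}" for k
  have linT1: "linear (\<lambda>a. T a - a)"
    by (intro linear_compose_sub bounded_linear.linear[OF blT] linear_id[unfolded id_def])
  have C_convex: "convex (C k)" for k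
  proof -
    have "{a. norm (T a - a) \<le> 1 / real (Suc k)} = (\<lambda>a. T a - a) -` cball 0 (1 / real (Suc k))"
      by auto
    then show ?thesis
      unfolding C_def using convex_linear_vimage[OF linT1 convex_cball] by (simp only: convex_Int convex_convex_hull)
  qed
  have C_ne: "C k \<noteq> {}" for k
    using cesaro_almost_invariant[OF bounded_linear.linear[OF blT] bound, of "1 / real (Suc k)" k]
    by (auto simp: C_def)
  have C_dec: "decseq C"
  proof (rule decseq_SucI)
    fix k
    have "convex hull {(T ^^ j) y |j. j \<ge> Suc k} \<subseteq> convex hull {(T ^^ j) y |j. j \<ge> k}"
      by (rule hull_mono) auto
    moreover have "1 / real (Suc (Suc k)) \<le> 1 / real (Suc k)" by (simp add: frac_le)
    ultimately show "C (Suc k) \<subseteq> C k" unfolding C_def by fastforce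
  qed
  have C_approx: "\<exists>B k. \<forall>a\<in>C k. \<exists>u\<in>M. norm (a - \<iota> u) \<le> \<epsilon> \<and> Re (\<tau> (adj u o\<^sub>L u)) \<le> B"
    if e: "\<epsilon> > 0" for \<epsilon>
  proof -
    obtain B n0 where B: "\<And>n. n \<ge> n0 \<Longrightarrow>
        \<exists>u\<in>M. norm ((T ^^ n) y - \<iota> u) \<le> \<epsilon> \<and> Re (\<tau> (adj u o\<^sub>L u)) \<le> B"
      using smoothing_approximable[OF assms(8) pos bound e] by blast
    \<comment> \<open>The tail from \<open>n0\<close> on is where smoothing gives approximants with
      a common bound \<open>B\<close>; the approximable points form a convex set, so the bound
      survives the hull.\<close>
    have "convex hull {(T ^^ j) y |j. j \<ge> n0}
        \<subseteq> {a. \<exists>u\<in>M. norm (a - \<iota> u) \<le> \<epsilon> \<and> Re (\<tau> (adj u o\<^sub>L u)) \<le> B}"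
      by (rule hull_minimal) (use B in blast, rule convex_approximable[OF subspace_M \<iota>_add \<iota>_scaleR
            \<tau>_square_nonneg \<tau>_square_convex_combination])
    then show ?thesis by (intro exI[of _ B] exI[of _ n0]) (auto simp: C_def)
  qed
  obtain z where z: "\<And>k. z \<in> closure (C k)"
  proof (rule nested_convex_common_point[where V = M and j = \<iota>
        and q = "\<lambda>u. Re (\<tau> (adj u o\<^sub>L u))"])
    show "(norm (\<iota> u))\<^sup>2 \<le> Re (\<tau> id_blinfun) * Re (\<tau> (adj u o\<^sub>L u))" if "u \<in> M" for u
      by (rule norm_\<iota>_sq_le[OF that])
  qed (rule subspace_M \<iota>_add \<iota>_scaleR \<tau>_square_nonneg \<tau>_square_convex_combination
      C_convex C_ne C_dec C_approx that; assumption)+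
  \<comment> \<open>Positivity and the lower bound \<open>c\<close> define a closed convex set
    containing the orbit; hence they hold on the closure of \<open>C 0\<close>, and \<open>z\<close>
    is not 0.\<close>
  have "convex hull {(T ^^ j) y |j. j \<ge> 0} \<subseteq> {a \<in> L1_pos M \<iota>. c \<le> norm a}"
    by (rule hull_minimal) (use pos c(2) in auto, rule convex_L1_pos_norm_ge)
  then have "C 0 \<subseteq> L1_pos M \<iota> \<inter> {a. c \<le> norm a}" by (auto simp: C_def)
  moreover have "closed (L1_pos M \<iota> \<inter> {a. c \<le> norm a})"
    by (intro closed_Int closed_Collect_le continuous_intros) (simp add: L1_pos_def)
  ultimately have "closure (C 0) \<subseteq> L1_pos M \<iota> \<inter> {a. c \<le> norm a}" by (rule closure_minimal)
  then have zpos: "z \<in> L1_pos M \<iota>" and "c \<le> norm z" using z[of 0] by auto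
  then have "z \<noteq> 0" using c0 by auto
  have "norm (T z - z) \<le> 1 / real (Suc k)" for k
  proof -
    have "closed {a. norm (T a - a) \<le> 1 / real (Suc k)}"
      by (intro closed_Collect_le continuous_intros bounded_linear.continuous_on[OF blT])
    then have "closure (C k) \<subseteq> {a. norm (T a - a) \<le> 1 / real (Suc k)}"
      by (intro closure_minimal) (auto simp: C_def)
    then show ?thesis using z[of k] by auto
  qed
  then have "norm (T z - z) \<le> 0"
    by (metis add_0 field_le_epsilon less_imp_le nat_approx_posE order_trans)
  then show "\<exists>z. z \<in> L1_pos M \<iota> \<and> z \<noteq> 0 \<and> T z = z" using zpos \<open>z \<noteq> 0\<close> by auto
qed

end
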